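(* Let $\Phi$ be an irreducible affine reflection system with $\mathring{\Phi}$ of type $B_n$ ($n\ge 2$). Then $\Psi\subseteq\Phi$ is a maximal closed subroot system with semi-closed gradient if and only if there exist a proper non-empty subset $J\subseteq\{1,\dots,n\}$ and disjoint subsets $Z_1,Z_2\subseteq\Lambda_s$ such that $Z_1$ and $Z_2$ are unions of cosets modulo $\Lambda_\ell$, $\Lambda_s=Z_1\cup Z_2$ and $$\Psi=\{\pm\epsilon_i\oplus Z_1,\ \pm\epsilon_j\oplus Z_2:\ i\notin J,\ j\in J\}\cup\{(\pm\epsilon_p\pm\epsilon_q)\oplus\Lambda_\ell:\ p\neq q,\ p,q\notin J\text{ or }p,q\in J\}.$$
   Context: Finite root systems: $V$ is a finite-dimensional real Euclidean space with inner product $(\cdot,\cdot)$. A finite root system $\mathring{\Phi}\subset V$ is a finite spanning set with $0\notin\mathring{\Phi}$, $s_\alpha(\mathring{\Phi})=\mathring{\Phi}$ and $(\beta,\alpha^\vee)\in\mathbb{Z}$ for all $\alpha,\beta\in\mathring{\Phi}$, where $\alpha^\vee=2\alpha/(\alpha,\alpha)$ and $s_\alpha(v)=v-(v,\alpha^\vee)\alpha$. $\mathring{\Phi}_s$ and $\mathring{\Phi}_\ell$ are the sets of short and long roots. With $\epsilon_1,\dots,\epsilon_n$ an orthonormal basis, $B_n$ has $\mathring{\Phi}_s=\{\pm\epsilon_i:1\le i\le n\}$ and $\mathring{\Phi}_\ell=\{\pm\epsilon_i\pm\epsilon_j:i\neq j\}$. Extension datum (for reduced $\mathring{\Phi}$):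 a family $(\Lambda_\alpha)_{\alpha\in\mathring{\Phi}\cup\{0\}}$ of subsets of a finite-dimensional real vector space $Y$ such that (1) $\Lambda_\beta-(\beta,\alpha^\vee)\Lambda_\alpha\subseteq\Lambda_{s_\alpha(\beta)}$ for all $\alpha,\beta\in\mathring{\Phi}$; (2) $0\in\Lambda_\alpha$ for all $\alpha\in\mathring{\Phi}\cup\{0\}$; (3) $Y$ is the real span of $\bigcup_\alpha\Lambda_\alpha$. For $\mathring{\Phi}$ irreducible, $\Lambda_\alpha$ ($\alpha\in\mathring{\Phi}$) depends only on the length of $\alpha$; the common values on short and long roots are denoted $\Lambda_s$ and $\Lambda_\ell$. For type $B_n$ one has $\Lambda_s+\Lambda_\ell\subseteq\Lambda_s$ and $\Lambda_\ell+2\Lambda_s\subseteq\Lambda_\ell$, so $\Lambda_s$ is a union of cosets modulo $\Lambda_\ell$; $\Lambda_\ell$ is a subgroup of $Y$ automatically for $n\ge3$, and it is a standing assumption that $\Lambda_\ell$ is a subgroup also for $n=2$. Affine reflection system: up to isomorphism, every affine reflection system is $\Phi=\bigcup_{\alpha\in\mathring{\Phi}\cup\{0\}}\alpha\oplus\Lambda_\alpha\subset X=V\oplus Y$ with form $(v_1\oplus y_1,v_2\oplus y_2)_X=(v_1,v_2)$, for a finite root system $\mathring{\Phi}$ and an extension datum; it is irreducible iff $\mathring{\Phi}$ is. Here $\alpha\oplus S=\{\alpha\oplus y:y\in S\}$ for a subset $S\subseteq Y$, and displayed sets of such expressions denote their unions. The real roots are $\Phi^{\mathrm{re}}=\bigcup_{\alpha\in\mathring{\Phi}}\alpha\oplus\Lambda_\alpha$,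 and $s_{\alpha\oplus y}(\beta\oplus z)=s_\alpha(\beta)\oplus(z-(\beta,\alpha^\vee)y)$. Subroot systems: a proper non-empty subset $\Psi\subsetneq\Phi^{\mathrm{re}}$ is a subroot system if $s_a(b)\in\Psi$ for all $a,b\in\Psi$; it is closed if $a,b\in\Psi$ and $a+b\in\Phi^{\mathrm{re}}$ imply $a+b\in\Psi$; it is a maximal closed subroot system if it is a closed subroot system and there is no closed subroot system $\Psi'$ with $\Psi\subsetneq\Psi'\subsetneq\Phi^{\mathrm{re}}$. The gradient is $\mathrm{Gr}(\Psi)=\{\alpha\in\mathring{\Phi}:\exists y\in\Lambda_\alpha,\ \alpha\oplus y\in\Psi\}$. Semi-closed: a subset $\mathring{\Phi}'\subseteq\mathring{\Phi}$ that is stable under the reflections in its own elements is closed if $\alpha,\beta\in\mathring{\Phi}'$, $\alpha+\beta\in\mathring{\Phi}$ imply $\alpha+\beta\in\mathring{\Phi}'$; it is semi-closed if it is not closed and whenever $\alpha,\beta\in\mathring{\Phi}'$ with $\alpha+\beta\in\mathring{\Phi}\setminus\mathring{\Phi}'$ one has $\alpha,\beta\in\mathring{\Phi}_s$ and $\alpha+\beta\in\mathring{\Phi}_\ell$.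
   Formalization: Z_1 and Z_2 are additionally required to be non-empty; if one of them is empty, the gradient of the displayed Ψ is closed and hence not semi-closed, so the "if" direction would fail. *)

theory Defs
  imports "HOL-Analysis.Analysis"
begin

definition coroot :: "'v::euclidean_space \<Rightarrow> 'v" where
  "coroot \<alpha> = (2 / (\<alpha> \<bullet> \<alpha>)) *\<^sub>R \<alpha>"

definition refl_root :: "'v::euclidean_space \<Rightarrow> 'v \<Rightarrow> 'v" where
  "refl_root \<alpha> v = v - (v \<bullet> coroot \<alpha>) *\<^sub>R \<alpha>"

definition finite_root_system :: "'v::euclidean_space set \<Rightarrow> bool" where
  "finite_root_system R \<longleftrightarrow>
     finite R \<and> span R = UNIV \<and> 0 \<notin> R \<and>
     (\<forall>\<alpha>\<in>R. refl_root \<alpha> ` R = R) \<and>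
     (\<forall>\<alpha>\<in>R. \<forall>\<beta>\<in>R. \<beta> \<bullet> coroot \<alpha> \<in> \<int>)"

definition reduced_roots :: "'v::euclidean_space set \<Rightarrow> bool" where
  "reduced_roots R \<longleftrightarrow> (\<forall>\<alpha>\<in>R. \<forall>c. c *\<^sub>R \<alpha> \<in> R \<longrightarrow> c = 1 \<or> c = -1)"

definition irreducible_roots :: "'v::euclidean_space set \<Rightarrow> bool" where
  "irreducible_roots R \<longleftrightarrow>
     R \<noteq> {} \<and>
     \<not> (\<exists>A B. A \<noteq> {} \<and> B \<noteq> {} \<and> A \<inter> B = {} \<and> A \<union> B = R \<and> (\<forall>a\<in>A. \<forall>b\<in>B. a \<bullet> b = 0))"

text \<open>Short and long roots of a reduced irreducible system are those of minimal and
  maximal length; the convention for systems with a single root length is immaterial here.\<close>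

definition short_roots :: "'v::euclidean_space set \<Rightarrow> 'v set" where
  "short_roots R = {\<alpha>\<in>R. \<forall>\<beta>\<in>R. norm \<alpha> \<le> norm \<beta>}"

definition long_roots :: "'v::euclidean_space set \<Rightarrow> 'v set" where
  "long_roots R = {\<alpha>\<in>R. \<forall>\<beta>\<in>R. norm \<beta> \<le> norm \<alpha>}"

definition orthonormal_basis :: "nat \<Rightarrow> (nat \<Rightarrow> 'v::euclidean_space) \<Rightarrow> bool" where
  "orthonormal_basis n \<epsilon> \<longleftrightarrow>
     (\<forall>i\<in>{1..n}. \<forall>j\<in>{1..n}. \<epsilon> i \<bullet> \<epsilon> j = (if i = j then 1 else 0)) \<and>
     span (\<epsilon> ` {1..n}) = UNIV"

definition roots_B :: "nat \<Rightarrow> (nat \<Rightarrow> 'v::euclidean_space) \<Rightarrow> 'v set" where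
  "roots_B n \<epsilon> =
     {s *\<^sub>R \<epsilon> i | s i. s \<in> {1, -1} \<and> i \<in> {1..n}} \<union>
     {s *\<^sub>R \<epsilon> i + t *\<^sub>R \<epsilon> j | s t i j.
        s \<in> {1, -1} \<and> t \<in> {1, -1} \<and> i \<in> {1..n} \<and> j \<in> {1..n} \<and> i \<noteq> j}"

text \<open>The vector space \<open>Y\<close> is a finite-dimensional subspace of an arbitrary real vector
  space (rather than a type of class \<open>euclidean_space\<close>, which would exclude \<open>Y = 0\<close>).
  Only the values of \<open>\<Lambda>\<close> on \<open>R \<union> {0}\<close> matter.\<close>

definition extension_datum ::
    "'v::euclidean_space set \<Rightarrow> 'y::real_vector set \<Rightarrow> ('v \<Rightarrow> 'y set) \<Rightarrow> bool" where
  "extension_datum R Y \<Lambda> \<longleftrightarrow>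
     subspace Y \<and> (\<exists>B. finite B \<and> span B = Y) \<and>
     (\<forall>\<alpha>\<in>insert 0 R. \<Lambda> \<alpha> \<subseteq> Y) \<and>
     (\<forall>\<alpha>\<in>R. \<forall>\<beta>\<in>R.
        {z - (\<beta> \<bullet> coroot \<alpha>) *\<^sub>R y | z y. z \<in> \<Lambda> \<beta> \<and> y \<in> \<Lambda> \<alpha>} \<subseteq> \<Lambda> (refl_root \<alpha> \<beta>)) \<and>
     (\<forall>\<alpha>\<in>insert 0 R. 0 \<in> \<Lambda> \<alpha>) \<and>
     span (\<Union>\<alpha>\<in>insert 0 R. \<Lambda> \<alpha>) = Y"

text \<open>An affine reflection system is given through its structure theorem: a finite root
  system together with an extension datum. The axioms in \<open>extension_datum\<close> are those
  for reduced finite root systems.\<close>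

definition irreducible_affine_reflection_datum ::
    "'v::euclidean_space set \<Rightarrow> 'y::real_vector set \<Rightarrow> ('v \<Rightarrow> 'y set) \<Rightarrow> bool" where
  "irreducible_affine_reflection_datum R Y \<Lambda> \<longleftrightarrow>
     finite_root_system R \<and> reduced_roots R \<and> irreducible_roots R \<and> extension_datum R Y \<Lambda>"

definition affine_roots ::
    "'v::euclidean_space set \<Rightarrow> ('v \<Rightarrow> 'y::real_vector set) \<Rightarrow> ('v \<times> 'y) set" where
  "affine_roots R \<Lambda> = (\<Union>\<alpha>\<in>insert 0 R. {\<alpha>} \<times> \<Lambda> \<alpha>)"

definition real_roots ::
    "'v::euclidean_space set \<Rightarrow> ('v \<Rightarrow> 'y::real_vector set) \<Rightarrow> ('v \<times> 'y) set" where
  "real_roots R \<Lambda> = (\<Union>\<alpha>\<in>R. {\<alpha>} \<times> \<Lambda> \<alpha>)"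

text \<open>The common values of \<open>\<Lambda>\<close> on the short and on the long roots. They exist
  for every extension datum of an irreducible system.\<close>

definition Lambda_short ::
    "'v::euclidean_space set \<Rightarrow> ('v \<Rightarrow> 'y::real_vector set) \<Rightarrow> 'y set" where
  "Lambda_short R \<Lambda> = (THE S. \<forall>\<alpha>\<in>short_roots R. \<Lambda> \<alpha> = S)"

definition Lambda_long ::
    "'v::euclidean_space set \<Rightarrow> ('v \<Rightarrow> 'y::real_vector set) \<Rightarrow> 'y set" where
  "Lambda_long R \<Lambda> = (THE S. \<forall>\<alpha>\<in>long_roots R. \<Lambda> \<alpha> = S)"

definition additive_subgroup :: "'y::real_vector set \<Rightarrow> bool" where
  "additive_subgroup S \<longleftrightarrow> 0 \<in> S \<and> (\<forall>x\<in>S. \<forall>y\<in>S. x + y \<in> S) \<and> (\<forall>x\<in>S. - x \<in> S)"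

text \<open>The empty union is included here, so the classification has to demand nonempty
  coset unions separately: for an empty \<open>Z\<^sub>1\<close> or \<open>Z\<^sub>2\<close> the gradient would be of the form
  \<open>B \<union> D\<close>, which is closed and therefore not semi-closed.\<close>

definition union_of_cosets :: "'y::real_vector set \<Rightarrow> 'y set \<Rightarrow> bool" where
  "union_of_cosets L Z \<longleftrightarrow> (\<exists>A. Z = (\<Union>a\<in>A. (\<lambda>l. a + l) ` L))"

fun affine_refl ::
    "'v::euclidean_space \<times> 'y::real_vector \<Rightarrow> 'v \<times> 'y \<Rightarrow> 'v \<times> 'y" where
  "affine_refl (\<alpha>, y) (\<beta>, z) = (refl_root \<alpha> \<beta>, z - (\<beta> \<bullet> coroot \<alpha>) *\<^sub>R y)"

definition subroot_system ::
    "'v::euclidean_space set \<Rightarrow> ('v \<Rightarrow> 'y::real_vector set) \<Rightarrow> ('v \<times> 'y) set \<Rightarrow> bool" where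
  "subroot_system R \<Lambda> \<Psi> \<longleftrightarrow>
     \<Psi> \<subset> real_roots R \<Lambda> \<and> \<Psi> \<noteq> {} \<and> (\<forall>a\<in>\<Psi>. \<forall>b\<in>\<Psi>. affine_refl a b \<in> \<Psi>)"

definition closed_subroot_system ::
    "'v::euclidean_space set \<Rightarrow> ('v \<Rightarrow> 'y::real_vector set) \<Rightarrow> ('v \<times> 'y) set \<Rightarrow> bool" where
  "closed_subroot_system R \<Lambda> \<Psi> \<longleftrightarrow>
     subroot_system R \<Lambda> \<Psi> \<and>
     (\<forall>a\<in>\<Psi>. \<forall>b\<in>\<Psi>. a + b \<in> real_roots R \<Lambda> \<longrightarrow> a + b \<in> \<Psi>)"

definition maximal_closed_subroot_system ::
    "'v::euclidean_space set \<Rightarrow> ('v \<Rightarrow> 'y::real_vector set) \<Rightarrow> ('v \<times> 'y) set \<Rightarrow> bool" where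
  "maximal_closed_subroot_system R \<Lambda> \<Psi> \<longleftrightarrow>
     closed_subroot_system R \<Lambda> \<Psi> \<and>
     \<not> (\<exists>\<Psi>'. closed_subroot_system R \<Lambda> \<Psi>' \<and> \<Psi> \<subset> \<Psi>' \<and> \<Psi>' \<subset> real_roots R \<Lambda>)"

definition gradient ::
    "'v::euclidean_space set \<Rightarrow> ('v \<Rightarrow> 'y::real_vector set) \<Rightarrow> ('v \<times> 'y) set \<Rightarrow> 'v set" where
  "gradient R \<Lambda> \<Psi> = {\<alpha>\<in>R. \<exists>y\<in>\<Lambda> \<alpha>. (\<alpha>, y) \<in> \<Psi>}"

definition reflection_stable :: "'v::euclidean_space set \<Rightarrow> 'v set \<Rightarrow> bool" where
  "reflection_stable R S \<longleftrightarrow> S \<subseteq> R \<and> (\<forall>\<alpha>\<in>S. \<forall>\<beta>\<in>S. refl_root \<alpha> \<beta> \<in> S)"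

definition closed_roots :: "'v::euclidean_space set \<Rightarrow> 'v set \<Rightarrow> bool" where
  "closed_roots R S \<longleftrightarrow>
     reflection_stable R S \<and> (\<forall>\<alpha>\<in>S. \<forall>\<beta>\<in>S. \<alpha> + \<beta> \<in> R \<longrightarrow> \<alpha> + \<beta> \<in> S)"

definition semi_closed_roots :: "'v::euclidean_space set \<Rightarrow> 'v set \<Rightarrow> bool" where
  "semi_closed_roots R S \<longleftrightarrow>
     reflection_stable R S \<and> \<not> closed_roots R S \<and>
     (\<forall>\<alpha>\<in>S. \<forall>\<beta>\<in>S. \<alpha> + \<beta> \<in> R - S \<longrightarrow>
        \<alpha> \<in> short_roots R \<and> \<beta> \<in> short_roots R \<and> \<alpha> + \<beta> \<in> long_roots R)"

end

theory Submission
  imports Defs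
begin

text \<open>
  Write \<open>S\<close>, \<open>L\<close> for \<open>\<Lambda>\<^sub>s\<close>, \<open>\<Lambda>\<^sub>\<ell>\<close>. Since \<open>S + L \<subseteq> S\<close> and \<open>2S \<subseteq> L\<close>, every \<open>L\<close>-coset in \<open>S\<close> is
  stable under negation. Hence if \<open>Z\<^sub>1\<close> and \<open>Z\<^sub>2\<close> are disjoint, no sum of short roots
  \<open>\<plusminus>\<epsilon>\<^sub>i \<oplus> z\<^sub>1\<close>, \<open>\<plusminus>\<epsilon>\<^sub>j \<oplus> z\<^sub>2\<close> from the two blocks is a root, which makes the displayed set closed. It is
  maximal: an additional short root yields a long root meeting both blocks, reflections in that
  long root carry \<open>Z\<^sub>1\<close> and \<open>Z\<^sub>2\<close> to the opposite blocks, and the full set of short roots generates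
  everything by sums.

  Conversely, if the gradient of a maximal \<open>\<Psi>\<close> is semi-closed, it contains \<open>\<plusminus>\<epsilon>\<^sub>i\<close>, \<open>\<plusminus>\<epsilon>\<^sub>j\<close> but none of
  \<open>\<plusminus>\<epsilon>\<^sub>i \<plusminus> \<epsilon>\<^sub>j\<close>. Let \<open>J\<close> be the class of \<open>j\<close> under the equivalence relation generated by the long roots in
  the gradient, \<open>Z\<^sub>2\<close> the union of the \<open>L\<close>-cosets met by \<open>\<Psi>\<close> over \<open>J\<close>, and \<open>Z\<^sub>1 = S - Z\<^sub>2\<close>. Closedness
  puts \<open>\<Psi>\<close> inside the set displayed for \<open>J, Z\<^sub>1, Z\<^sub>2\<close>, and maximality gives equality.
\<close>

section \<open>Reflections, unions of cosets and gradients in general\<close>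

lemma inner_coroot: "\<beta> \<bullet> coroot \<alpha> = 2 * (\<beta> \<bullet> \<alpha>) / (\<alpha> \<bullet> \<alpha>)"
  by (simp add: coroot_def)

lemma inner_refl_root:
  "refl_root \<alpha> \<beta> \<bullet> refl_root \<alpha> \<beta> = \<beta> \<bullet> \<beta>"
  by (cases "\<alpha> = 0")
    (simp_all add: refl_root_def inner_coroot inner_diff_left inner_diff_right inner_commute field_simps)

lemma refl_root_invol: "refl_root \<alpha> (refl_root \<alpha> \<beta>) = \<beta>"
\<comment> \<open>Division by zero yields 0, so \<open>coroot 0 = 0\<close> and
  \<open>refl_root 0\<close> is the identity.\<close>
proof (cases "\<alpha> = 0")
  case False
  have "refl_root \<alpha> \<beta> \<bullet> coroot \<alpha> = - (\<beta> \<bullet> coroot \<alpha>)"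
    using False by (simp add: refl_root_def inner_coroot inner_diff_left field_simps)
  then show ?thesis
    by (subst refl_root_def) (simp add: refl_root_def)
qed (simp add: refl_root_def)

lemma refl_root_self: "\<alpha> \<noteq> 0 \<Longrightarrow> refl_root \<alpha> \<alpha> = - \<alpha>"
  by (simp add: refl_root_def inner_coroot scaleR_2)

text \<open>Reflection formulas scale by real numbers that happen to be integers, while
  \<open>additive_subgroup\<close> only knows sums and negatives; this bridges the two.\<close>

lemma additive_subgroup_scale_int:
  assumes "additive_subgroup A" "x \<in> A" "m \<in> \<int>"
  shows "m *\<^sub>R x \<in> A"
proof -
  have nat: "real k *\<^sub>R x \<in> A" for k
    using assms by (induction k) (auto simp: additive_subgroup_def scaleR_add_left)
  obtain j where j: "m = of_int j"
    using assms(3) by (auto elim: Ints_cases)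
  show ?thesis
  proof (cases "j \<ge> 0")
    case True
    then have "m = real (nat j)" by (simp add: j)
    then show ?thesis using nat by metis
  next
    case False
    then have "m = - real (nat (- j))" by (simp add: j)
    then show ?thesis
      using nat[of "nat (- j)"] assms(1) by (simp add: additive_subgroup_def)
  qed
qed

text \<open>Since \<open>0 \<in> L\<close>, the set \<open>Z\<close> can serve as its own family of
  representatives. Translation invariance is the form in which coset unions are used below.\<close>

lemma union_of_cosets_iff:
  assumes "additive_subgroup L"
  shows "union_of_cosets L Z \<longleftrightarrow> (\<forall>z\<in>Z. \<forall>l\<in>L. z + l \<in> Z)"
proof
  assume "union_of_cosets L Z"
  then obtain A where Z: "Z = (\<Union>a\<in>A. (\<lambda>l. a + l) ` L)"
    by (auto simp: union_of_cosets_def)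
  show "\<forall>z\<in>Z. \<forall>l\<in>L. z + l \<in> Z"
  proof (intro ballI)
    fix z l assume "z \<in> Z" "l \<in> L"
    then obtain a l' where a: "a \<in> A" "l' \<in> L" "z = a + l'" by (auto simp: Z)
    then have "l' + l \<in> L" "z + l = a + (l' + l)"
      using assms \<open>l \<in> L\<close> by (auto simp: additive_subgroup_def add.assoc)
    then show "z + l \<in> Z" unfolding Z using a(1) by blast
  qed
next
  assume *: "\<forall>z\<in>Z. \<forall>l\<in>L. z + l \<in> Z"
  have "0 \<in> L" using assms by (simp add: additive_subgroup_def)
  then have "Z = (\<Union>a\<in>Z. (\<lambda>l. a + l) ` L)"
    using * by (force intro: rev_image_eqI)
  then show "union_of_cosets L Z" unfolding union_of_cosets_def by blast
qed

lemma union_of_cosets_translate: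
  assumes "additive_subgroup L" "union_of_cosets L Z" "z \<in> Z" "w - z \<in> L"
  shows "w \<in> Z"
proof -
  have "z + (w - z) \<in> Z" using assms by (simp only: union_of_cosets_iff)
  then show ?thesis by simp
qed

lemma gradient_subset: "gradient R \<Lambda> \<Psi> \<subseteq> R"
  by (auto simp: gradient_def)

lemma gradient_iff:
  assumes "\<Psi> \<subseteq> real_roots R \<Lambda>"
  shows "\<alpha> \<in> gradient R \<Lambda> \<Psi> \<longleftrightarrow> (\<exists>y. (\<alpha>, y) \<in> \<Psi>)"
  using assms by (auto simp: gradient_def real_roots_def)

lemma reflection_stable_gradient:
  assumes "subroot_system R \<Lambda> \<Psi>"
  shows "reflection_stable R (gradient R \<Lambda> \<Psi>)"
proof -
  have sub: "\<Psi> \<subseteq> real_roots R \<Lambda>"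
    using assms by (auto simp: subroot_system_def)
  have "refl_root \<alpha> \<beta> \<in> gradient R \<Lambda> \<Psi>"
    if h: "\<alpha> \<in> gradient R \<Lambda> \<Psi>" "\<beta> \<in> gradient R \<Lambda> \<Psi>" for \<alpha> \<beta>
  proof -
    obtain y z where "(\<alpha>, y) \<in> \<Psi>" "(\<beta>, z) \<in> \<Psi>"
      using h gradient_iff[OF sub] by meson
    then have "affine_refl (\<alpha>, y) (\<beta>, z) \<in> \<Psi>"
      using assms unfolding subroot_system_def by blast
    then show ?thesis by (auto simp: gradient_iff[OF sub])
  qed
  then show ?thesis by (simp add: reflection_stable_def gradient_subset)
qed

subsection \<open>Extension data of type B\<close>

locale type_B_datum =
  fixes n :: nat
    and \<epsilon> :: "nat \<Rightarrow> 'v::euclidean_space"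
    and Y :: "'y::real_vector set"
    and \<Lambda> :: "'v \<Rightarrow> 'y set"
  assumes two_le: "2 \<le> n"
    and basis: "orthonormal_basis n \<epsilon>"
    and datum: "irreducible_affine_reflection_datum (roots_B n \<epsilon>) Y \<Lambda>"
begin

abbreviation R :: "'v set" where "R \<equiv> roots_B n \<epsilon>"
abbreviation sgns :: "real set" where "sgns \<equiv> {1, -1}"

text \<open>\<open>S\<close> and \<open>L\<close> are values at fixed representatives; they are
  matched with the definite descriptions in \<open>Lambda_short_eq\<close> and
  \<open>Lambda_long_eq\<close>, once \<Lambda> is known to depend only on length.\<close>

definition S :: "'y set" where "S = \<Lambda> (\<epsilon> 1)"
definition L :: "'y set" where "L = \<Lambda> (\<epsilon> 1 + \<epsilon> 2)"

lemma inner_basis: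
  "i \<in> {1..n} \<Longrightarrow> j \<in> {1..n} \<Longrightarrow> \<epsilon> i \<bullet> \<epsilon> j = (if i = j then 1 else 0)"
  using basis by (simp add: orthonormal_basis_def)

lemma short_in_R: "s \<in> sgns \<Longrightarrow> i \<in> {1..n} \<Longrightarrow> s *\<^sub>R \<epsilon> i \<in> R"
  by (auto simp: roots_B_def)

lemma long_in_R:
  "s \<in> sgns \<Longrightarrow> t \<in> sgns \<Longrightarrow> p \<in> {1..n} \<Longrightarrow> q \<in> {1..n} \<Longrightarrow> p \<noteq> q \<Longrightarrow>
    s *\<^sub>R \<epsilon> p + t *\<^sub>R \<epsilon> q \<in> R"
  unfolding roots_B_def by blast

lemma root_cases [consumes 1, case_names short long]:
  assumes "\<alpha> \<in> R"
  obtains s i where "s \<in> sgns" "i \<in> {1..n}" "\<alpha> = s *\<^sub>R \<epsilon> i"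
  | s t p q where "s \<in> sgns" "t \<in> sgns" "p \<in> {1..n}" "q \<in> {1..n}" "p \<noteq> q"
      "\<alpha> = s *\<^sub>R \<epsilon> p + t *\<^sub>R \<epsilon> q"
  using assms unfolding roots_B_def by blast

lemma inner_short: "s \<in> sgns \<Longrightarrow> i \<in> {1..n} \<Longrightarrow> (s *\<^sub>R \<epsilon> i) \<bullet> (s *\<^sub>R \<epsilon> i) = 1"
  by (auto simp: inner_basis)

lemma inner_long:
  "s \<in> sgns \<Longrightarrow> t \<in> sgns \<Longrightarrow> p \<in> {1..n} \<Longrightarrow> q \<in> {1..n} \<Longrightarrow> p \<noteq> q \<Longrightarrow>
    (s *\<^sub>R \<epsilon> p + t *\<^sub>R \<epsilon> q) \<bullet> (s *\<^sub>R \<epsilon> p + t *\<^sub>R \<epsilon> q) = 2"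
  by (auto simp: inner_basis inner_add_left inner_add_right)

lemma inner_root_self: "\<alpha> \<in> R \<Longrightarrow> \<alpha> \<bullet> \<alpha> = 1 \<or> \<alpha> \<bullet> \<alpha> = 2"
  by (erule root_cases) (use inner_short inner_long in blast)+

lemma root_nonzero: "\<alpha> \<in> R \<Longrightarrow> \<alpha> \<noteq> 0"
  using inner_root_self by fastforce

lemma inner_roots_Ints:
  assumes "\<alpha> \<in> R" "\<beta> \<in> R"
  shows "\<alpha> \<bullet> \<beta> \<in> \<int>"
proof -
  have e: "\<epsilon> i \<bullet> \<epsilon> j \<in> \<int>" if "i \<in> {1..n}" "j \<in> {1..n}" for i j
    using that by (simp add: inner_basis)
  have s: "s \<in> \<int>" if "s \<in> sgns" for s using that by auto
  show ?thesis
    using assms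
    by (elim root_cases) (simp_all add: inner_add_left inner_add_right e s Ints_add Ints_mult del: insert_iff)
qed

text \<open>Both lengths occur because \<open>2 \<le> n\<close>, so minimal and maximal norm mean
  norm square 1 and 2. The test \<open>\<alpha> \<bullet> \<alpha> = 1\<close> then stands for
  shortness throughout.\<close>

lemma short_roots_R: "short_roots R = {\<alpha> \<in> R. \<alpha> \<bullet> \<alpha> = 1}"
proof -
  have "\<epsilon> 1 \<in> R" using short_in_R[of 1 1] two_le by simp
  moreover have "\<epsilon> 1 \<bullet> \<epsilon> 1 = 1" using inner_basis[of 1 1] two_le by simp
  ultimately show ?thesis
    using inner_root_self unfolding short_roots_def norm_le by force
qed

lemma long_roots_R: "long_roots R = {\<alpha> \<in> R. \<alpha> \<bullet> \<alpha> = 2}"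
proof -
  have "\<epsilon> 1 + \<epsilon> 2 \<in> R" using long_in_R[of 1 1 1 2] two_le by simp
  moreover have "(\<epsilon> 1 + \<epsilon> 2) \<bullet> (\<epsilon> 1 + \<epsilon> 2) = 2" using inner_long[of 1 1 1 2] two_le by simp
  ultimately show ?thesis
    using inner_root_self unfolding long_roots_def norm_le by force
qed

lemma refl_root_closed: "\<alpha> \<in> R \<Longrightarrow> \<beta> \<in> R \<Longrightarrow> refl_root \<alpha> \<beta> \<in> R"
  using datum unfolding irreducible_affine_reflection_datum_def finite_root_system_def by blast

lemma refl_short:
  "s \<in> sgns \<Longrightarrow> i \<in> {1..n} \<Longrightarrow> refl_root (s *\<^sub>R \<epsilon> i) \<beta> = \<beta> - (2 * (\<beta> \<bullet> \<epsilon> i)) *\<^sub>R \<epsilon> i"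
  by (auto simp: refl_root_def inner_coroot inner_basis)

lemma flip_sign:
  assumes "s \<in> sgns" "i \<in> {1..n}" "j \<in> {1..n}" "i \<noteq> j"
  shows "refl_root (s *\<^sub>R \<epsilon> i) (u *\<^sub>R \<epsilon> j + v *\<^sub>R \<epsilon> i) = u *\<^sub>R \<epsilon> j + (- v) *\<^sub>R \<epsilon> i"
proof -
  have "(u *\<^sub>R \<epsilon> j + v *\<^sub>R \<epsilon> i) \<bullet> \<epsilon> i = v"
    using assms by (simp add: inner_add_left inner_basis)
  then show ?thesis
    unfolding refl_short[OF assms(1,2)] by (simp add: scaleR_2 flip: scaleR_scaleR)
qed

lemma refl_long:
  "s \<in> sgns \<Longrightarrow> t \<in> sgns \<Longrightarrow> p \<in> {1..n} \<Longrightarrow> q \<in> {1..n} \<Longrightarrow> p \<noteq> q \<Longrightarrow>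
    refl_root (s *\<^sub>R \<epsilon> p + t *\<^sub>R \<epsilon> q) \<beta> =
      \<beta> - (\<beta> \<bullet> (s *\<^sub>R \<epsilon> p + t *\<^sub>R \<epsilon> q)) *\<^sub>R (s *\<^sub>R \<epsilon> p + t *\<^sub>R \<epsilon> q)"
  by (subst refl_root_def, subst inner_coroot, subst inner_long) auto

lemma Lambda_refl:
  "\<alpha> \<in> R \<Longrightarrow> \<beta> \<in> R \<Longrightarrow> z \<in> \<Lambda> \<beta> \<Longrightarrow> y \<in> \<Lambda> \<alpha> \<Longrightarrow>
    z - (\<beta> \<bullet> coroot \<alpha>) *\<^sub>R y \<in> \<Lambda> (refl_root \<alpha> \<beta>)"
  using datum unfolding irreducible_affine_reflection_datum_def extension_datum_def by blast

lemma zero_in_Lambda: "\<alpha> \<in> R \<Longrightarrow> 0 \<in> \<Lambda> \<alpha>"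
  using datum unfolding irreducible_affine_reflection_datum_def extension_datum_def by blast

text \<open>Taking \<open>y = 0\<close> in the datum axiom gives one inclusion; applied to the
  reflected root it gives the other, as reflections are involutions. So \<Lambda> is constant on
  reflection orbits.\<close>

lemma Lambda_refl_eq:
  assumes "\<alpha> \<in> R" "\<beta> \<in> R"
  shows "\<Lambda> (refl_root \<alpha> \<beta>) = \<Lambda> \<beta>"
proof -
  have sub: "\<Lambda> \<gamma> \<subseteq> \<Lambda> (refl_root \<alpha> \<gamma>)" if "\<gamma> \<in> R" for \<gamma>
    using Lambda_refl[OF assms(1) that _ zero_in_Lambda[OF assms(1)]] by auto
  show ?thesis
    using sub[OF assms(2)] sub[OF refl_root_closed[OF assms]] by (simp add: refl_root_invol)
qed

lemma Lambda_uminus: "\<alpha> \<in> R \<Longrightarrow> \<Lambda> (- \<alpha>) = \<Lambda> \<alpha>"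
  using Lambda_refl_eq[of \<alpha> \<alpha>] by (simp add: refl_root_self root_nonzero)

lemma Lambda_short_root:
  assumes "s \<in> sgns" "i \<in> {1..n}"
  shows "\<Lambda> (s *\<^sub>R \<epsilon> i) = S"
proof -
  have one: "1 \<in> {1..n}" using two_le by simp
  have "\<Lambda> (\<epsilon> i) = S"
  proof (cases "i = 1")
    case False
    have "refl_root (1 *\<^sub>R \<epsilon> 1 + (-1) *\<^sub>R \<epsilon> i) (1 *\<^sub>R \<epsilon> 1) = \<epsilon> i"
      using False one assms(2) by (subst refl_long) (auto simp: inner_basis inner_add_right inner_diff_right)
    then show ?thesis
      using Lambda_refl_eq[OF long_in_R[of 1 "-1" 1 i] short_in_R[of 1 1]] one assms(2) False by (simp add: S_def)
  qed (simp add: S_def)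
  moreover have "\<Lambda> (- \<epsilon> i) = \<Lambda> (\<epsilon> i)"
    using Lambda_uminus[OF short_in_R[of 1 i]] assms(2) by simp
  ultimately show ?thesis using assms(1) by (elim insertE emptyE) simp_all
qed

text \<open>The long roots form a single orbit: short reflections flip a sign (\<open>flip\<close>),
  and the reflection in \<open>\<epsilon> q - \<epsilon> r\<close> replaces one index by another
  (\<open>swap\<close>). At most two swaps lead to
  \<open>\<epsilon> 1 + \<epsilon> 2\<close>.\<close>

lemma Lambda_long_root:
  assumes s: "s \<in> sgns" and t: "t \<in> sgns" and p: "p \<in> {1..n}" and q: "q \<in> {1..n}" and pq: "p \<noteq> q"
  shows "\<Lambda> (s *\<^sub>R \<epsilon> p + t *\<^sub>R \<epsilon> q) = L"
proof -
  have one: "1 \<in> {1..n}" and two: "2 \<in> {1..n}" using two_le by auto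
  have flip: "\<Lambda> (\<epsilon> p + t *\<^sub>R \<epsilon> q) = \<Lambda> (- \<epsilon> p + t *\<^sub>R \<epsilon> q)"
    if "t \<in> sgns" "p \<in> {1..n}" "q \<in> {1..n}" "p \<noteq> q" for p q t
  proof -
    have "refl_root (1 *\<^sub>R \<epsilon> p) (1 *\<^sub>R \<epsilon> p + t *\<^sub>R \<epsilon> q) = - \<epsilon> p + t *\<^sub>R \<epsilon> q"
      using that by (subst refl_short) (auto simp: inner_basis inner_add_left algebra_simps scaleR_2)
    then show ?thesis
      using Lambda_refl_eq[OF short_in_R[of 1 p] long_in_R[of 1 t p q]] that by simp
  qed
  have swap: "\<Lambda> (\<epsilon> p + \<epsilon> q) = \<Lambda> (\<epsilon> p + \<epsilon> r)"
    if "p \<in> {1..n}" "q \<in> {1..n}" "r \<in> {1..n}" "p \<noteq> q" "p \<noteq> r" for p q r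
  proof (cases "q = r")
    case False
    have "refl_root (1 *\<^sub>R \<epsilon> q + (-1) *\<^sub>R \<epsilon> r) (1 *\<^sub>R \<epsilon> p + 1 *\<^sub>R \<epsilon> q) = \<epsilon> p + \<epsilon> r"
      using that False by (subst refl_long) (auto simp: inner_basis inner_add_left inner_add_right inner_diff_right)
    then show ?thesis
      using Lambda_refl_eq[OF long_in_R[of 1 "-1" q r] long_in_R[of 1 1 p q]] that False by simp
  qed simp
  have pos: "\<Lambda> (\<epsilon> p + \<epsilon> q) = L"
  proof (cases "p = 1")
    case True
    then show ?thesis using swap[of 1 q 2] one two pq q by (simp add: L_def)
  next
    case False
    then have "\<Lambda> (\<epsilon> p + \<epsilon> q) = \<Lambda> (\<epsilon> p + \<epsilon> 1)" using swap[of p q 1] one pq p q by simp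
    also have "\<dots> = L" using swap[of 1 p 2] one two p False by (simp add: add.commute L_def)
    finally show ?thesis .
  qed
  have "\<Lambda> (s *\<^sub>R \<epsilon> p + t *\<^sub>R \<epsilon> q) = \<Lambda> (\<epsilon> p + t *\<^sub>R \<epsilon> q)"
  proof (cases "s = 1")
    case False
    then have s: "s *\<^sub>R \<epsilon> p = - \<epsilon> p" using s by simp
    show ?thesis unfolding s by (rule flip[OF t p q pq, symmetric])
  qed simp
  also have "\<dots> = \<Lambda> (\<epsilon> p + \<epsilon> q)"
  proof (cases "t = 1")
    case False
    then have t: "t *\<^sub>R \<epsilon> q = - \<epsilon> q" using t by simp
    have "\<Lambda> (\<epsilon> q + 1 *\<^sub>R \<epsilon> p) = \<Lambda> (- \<epsilon> q + 1 *\<^sub>R \<epsilon> p)"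
      using pq by (intro flip[OF _ q p]) auto
    then show ?thesis unfolding t scaleR_one add.commute[of "\<epsilon> p"] by (rule sym)
  qed simp
  finally show ?thesis using pos by simp
qed

lemma Lambda_root:
  assumes "\<alpha> \<in> R"
  shows "\<Lambda> \<alpha> = (if \<alpha> \<bullet> \<alpha> = 1 then S else L)"
  using assms
proof (cases rule: root_cases)
  case (short s i)
  show ?thesis
    unfolding short(3) inner_short[OF short(1,2)] Lambda_short_root[OF short(1,2)] by simp
next
  case (long s t p q)
  show ?thesis
    unfolding long(6) inner_long[OF long(1-5)] Lambda_long_root[OF long(1-5)] by simp
qed

lemma Lambda_short_eq: "Lambda_short R \<Lambda> = S"
  unfolding Lambda_short_def
proof (rule the_equality)
  show "\<forall>\<alpha>\<in>short_roots R. \<Lambda> \<alpha> = S"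
    unfolding short_roots_R using Lambda_root by auto
  have "1 *\<^sub>R \<epsilon> 1 \<in> short_roots R"
    unfolding short_roots_R using short_in_R[of 1 1] inner_short[of 1 1] two_le by simp
  then show "T = S" if "\<forall>\<alpha>\<in>short_roots R. \<Lambda> \<alpha> = T" for T
    using that by (auto simp: S_def)
qed

lemma Lambda_long_eq: "Lambda_long R \<Lambda> = L"
  unfolding Lambda_long_def
proof (rule the_equality)
  show "\<forall>\<alpha>\<in>long_roots R. \<Lambda> \<alpha> = L"
    unfolding long_roots_R using Lambda_root by auto
  have "1 *\<^sub>R \<epsilon> 1 + 1 *\<^sub>R \<epsilon> 2 \<in> long_roots R"
    unfolding long_roots_R using long_in_R[of 1 1 1 2] inner_long[of 1 1 1 2] two_le by simp
  then show "T = L" if "\<forall>\<alpha>\<in>long_roots R. \<Lambda> \<alpha> = T" for T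
    using that by (auto simp: L_def)
qed

lemma zero_S: "0 \<in> S"
  using zero_in_Lambda[OF short_in_R[of 1 1]] two_le by (simp add: S_def)

text \<open>Reflecting \<open>\<epsilon> 1\<close> in itself with both values equal to
  \<open>x\<close> produces \<open>x - 2x\<close>.\<close>

lemma uminus_S:
  assumes "x \<in> S"
  shows "- x \<in> S"
proof -
  have e: "\<epsilon> 1 \<in> R" using short_in_R[of 1 1] two_le by simp
  have x: "x \<in> \<Lambda> (\<epsilon> 1)" using assms by (simp add: S_def)
  have "x - (\<epsilon> 1 \<bullet> coroot (\<epsilon> 1)) *\<^sub>R x \<in> \<Lambda> (\<epsilon> 1)"
    using Lambda_refl[OF e e x x] unfolding Lambda_refl_eq[OF e e] .
  then show ?thesis
    using root_nonzero[OF e] by (simp add: S_def inner_coroot scaleR_2)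
qed

text \<open>The long root \<open>\<epsilon> 1 + \<epsilon> 2\<close> pairs to 2 with the coroot of
  \<open>\<epsilon> 1\<close>. Starting from the value 0, the reflection with value
  \<open>- x\<close> yields \<open>2x\<close>.\<close>

lemma double_S:
  assumes "x \<in> S"
  shows "2 *\<^sub>R x \<in> L"
proof -
  have e: "\<epsilon> 1 \<in> R" "\<epsilon> 1 + \<epsilon> 2 \<in> R"
    using short_in_R[of 1 1] long_in_R[of 1 1 1 2] two_le by simp_all
  have x: "- x \<in> \<Lambda> (\<epsilon> 1)" using uminus_S[OF assms] by (simp add: S_def)
  have "0 - ((\<epsilon> 1 + \<epsilon> 2) \<bullet> coroot (\<epsilon> 1)) *\<^sub>R (- x) \<in> \<Lambda> (\<epsilon> 1 + \<epsilon> 2)"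
    using Lambda_refl[OF e zero_in_Lambda[OF e(2)] x] unfolding Lambda_refl_eq[OF e] .
  moreover have "(\<epsilon> 1 + \<epsilon> 2) \<bullet> coroot (\<epsilon> 1) = 2"
    using two_le by (simp add: inner_coroot inner_add_left inner_basis)
  ultimately show ?thesis by (simp add: L_def)
qed

end

text \<open>A second locale, because the assumption for \<open>n = 2\<close> speaks of
  \<open>L\<close>, which is defined in the first one.\<close>

locale type_B_datum_subgroup = type_B_datum n \<epsilon> Y \<Lambda>
  for n :: nat
    and \<epsilon> :: "nat \<Rightarrow> 'v::euclidean_space"
    and Y :: "'y::real_vector set"
    and \<Lambda> :: "'v \<Rightarrow> 'y set" +
  assumes long_subgroup: "n = 2 \<Longrightarrow> additive_subgroup L"
begin

text \<open>From \<open>n = 3\<close> on, \<open>\<epsilon> 1 + \<epsilon> 2\<close> and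
  \<open>\<epsilon> 1 + \<epsilon> 3\<close> are long roots with pairing 1, so the datum axiom gives
  closure under differences. For \<open>n = 2\<close> long roots are proportional or orthogonal, and
  the locale assumption steps in.\<close>

lemma L_additive_subgroup: "additive_subgroup L"
proof (cases "n = 2")
  case False
  then have ind: "1 \<in> {1..n}" "2 \<in> {1..n}" "3 \<in> {1..n}" using two_le by auto
  then have e: "\<epsilon> 1 + \<epsilon> 3 \<in> R" "\<epsilon> 1 + \<epsilon> 2 \<in> R"
    using long_in_R[of 1 1 1 3] long_in_R[of 1 1 1 2] by simp_all
  have c: "(\<epsilon> 1 + \<epsilon> 2) \<bullet> coroot (\<epsilon> 1 + \<epsilon> 3) = 1"
    using ind by (simp add: inner_coroot inner_add_left inner_add_right inner_basis)
  have L3: "\<Lambda> (\<epsilon> 1 + \<epsilon> 3) = L" using Lambda_long_root[of 1 1 1 3] ind by simp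
  have diff: "x - y \<in> L" if "x \<in> L" "y \<in> L" for x y
    using Lambda_refl[OF e, of x y] that
    unfolding Lambda_refl_eq[OF e] c L3 L_def[symmetric] by simp
  have zero: "0 \<in> L" using zero_in_Lambda[OF e(2)] by (simp add: L_def)
  have neg: "- x \<in> L" if "x \<in> L" for x using diff[OF zero that] by simp
  show ?thesis
    unfolding additive_subgroup_def using zero neg diff by (metis diff_minus_eq_add)
qed (rule long_subgroup)

lemma zero_L: "0 \<in> L" and add_L: "x \<in> L \<Longrightarrow> y \<in> L \<Longrightarrow> x + y \<in> L" and uminus_L: "x \<in> L \<Longrightarrow> - x \<in> L"
  using L_additive_subgroup by (simp_all add: additive_subgroup_def)

lemma S_add_L:
  assumes "x \<in> S" "y \<in> L"
  shows "x + y \<in> S"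
proof -
  have e: "\<epsilon> 1 + \<epsilon> 2 \<in> R" "\<epsilon> 1 \<in> R"
    using short_in_R[of 1 1] long_in_R[of 1 1 1 2] two_le by simp_all
  have "x \<in> \<Lambda> (\<epsilon> 1)" "- y \<in> \<Lambda> (\<epsilon> 1 + \<epsilon> 2)"
    using assms uminus_L by (simp_all add: S_def L_def)
  then have "x - (\<epsilon> 1 \<bullet> coroot (\<epsilon> 1 + \<epsilon> 2)) *\<^sub>R (- y) \<in> \<Lambda> (\<epsilon> 1)"
    using Lambda_refl[OF e] unfolding Lambda_refl_eq[OF e] by blast
  moreover have "\<epsilon> 1 \<bullet> coroot (\<epsilon> 1 + \<epsilon> 2) = 1"
    using two_le by (simp add: inner_coroot inner_add_left inner_add_right inner_basis)
  ultimately show ?thesis by (simp add: S_def)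
qed

lemma L_subset_S: "L \<subseteq> S"
  using S_add_L[OF zero_S] by auto

text \<open>Every reflection shifts values by elements of \<open>L\<close>, hence preserves
  \<open>L\<close>-cosets. For short \<alpha> the coroot is twice \<alpha> and
  \<open>double_S\<close> applies; for long \<alpha> the coroot is \<alpha> itself.\<close>

lemma coroot_scale_in_L:
  assumes "\<alpha> \<in> R" "\<beta> \<in> R" "y \<in> \<Lambda> \<alpha>"
  shows "(\<beta> \<bullet> coroot \<alpha>) *\<^sub>R y \<in> L"
proof -
  have int: "\<beta> \<bullet> \<alpha> \<in> \<int>" by (rule inner_roots_Ints[OF assms(2,1)])
  show ?thesis
  proof (cases "\<alpha> \<bullet> \<alpha> = 1")
    case True
    then have "(\<beta> \<bullet> \<alpha>) *\<^sub>R 2 *\<^sub>R y \<in> L"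
      using assms int by (intro additive_subgroup_scale_int[OF L_additive_subgroup] double_S)
        (simp_all add: Lambda_root)
    then show ?thesis using True by (simp add: inner_coroot mult.commute)
  next
    case False
    then have "\<alpha> \<bullet> \<alpha> = 2" using inner_root_self[OF assms(1)] by simp
    moreover have "(\<beta> \<bullet> \<alpha>) *\<^sub>R y \<in> L"
      using assms int False by (intro additive_subgroup_scale_int[OF L_additive_subgroup])
        (simp_all add: Lambda_root)
    ultimately show ?thesis by (simp add: inner_coroot)
  qed
qed

section \<open>Coordinate subspaces and the roots they contain\<close>

lemma orthogonal_spans:
  assumes "K \<subseteq> {1..n}" "K' \<subseteq> {1..n}" "K \<inter> K' = {}" "x \<in> span (\<epsilon> ` K)" "y \<in> span (\<epsilon> ` K')"
  shows "x \<bullet> y = 0"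
proof -
  have "orthogonal (\<epsilon> k) y" if "k \<in> K" for k
    using assms that
    by (intro orthogonal_to_span[OF assms(5)]) (auto simp: orthogonal_def inner_basis subset_iff)
  then have "orthogonal y x"
    by (intro orthogonal_to_span[OF assms(4)]) (auto simp: orthogonal_commute)
  then show ?thesis by (simp add: orthogonal_def inner_commute)
qed

lemma orthogonal_span_basis:
  "K \<subseteq> {1..n} \<Longrightarrow> x \<in> span (\<epsilon> ` K) \<Longrightarrow> i \<in> {1..n} \<Longrightarrow> i \<notin> K \<Longrightarrow> x \<bullet> \<epsilon> i = 0"
  by (rule orthogonal_spans[of K "{i}"]) (auto intro: span_base)

lemma short_in_span_iff:
  assumes "K \<subseteq> {1..n}" "s \<in> sgns" "i \<in> {1..n}"
  shows "s *\<^sub>R \<epsilon> i \<in> span (\<epsilon> ` K) \<longleftrightarrow> i \<in> K"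
proof
  assume "s *\<^sub>R \<epsilon> i \<in> span (\<epsilon> ` K)"
  moreover have "s *\<^sub>R \<epsilon> i \<bullet> \<epsilon> i \<noteq> 0" using assms by (auto simp: inner_basis)
  ultimately show "i \<in> K" using orthogonal_span_basis[OF assms(1) _ assms(3)] by blast
next
  assume "i \<in> K"
  then show "s *\<^sub>R \<epsilon> i \<in> span (\<epsilon> ` K)" by (intro span_scale span_base imageI)
qed

lemma long_in_span_iff:
  assumes "K \<subseteq> {1..n}" "s \<in> sgns" "t \<in> sgns" "p \<in> {1..n}" "q \<in> {1..n}" "p \<noteq> q"
  shows "s *\<^sub>R \<epsilon> p + t *\<^sub>R \<epsilon> q \<in> span (\<epsilon> ` K) \<longleftrightarrow> p \<in> K \<and> q \<in> K"
proof
  assume *: "s *\<^sub>R \<epsilon> p + t *\<^sub>R \<epsilon> q \<in> span (\<epsilon> ` K)"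
  have "(s *\<^sub>R \<epsilon> p + t *\<^sub>R \<epsilon> q) \<bullet> \<epsilon> p \<noteq> 0" "(s *\<^sub>R \<epsilon> p + t *\<^sub>R \<epsilon> q) \<bullet> \<epsilon> q \<noteq> 0"
    using assms by (auto simp: inner_basis inner_add_left)
  then show "p \<in> K \<and> q \<in> K"
    using orthogonal_span_basis[OF assms(1) * assms(4)] orthogonal_span_basis[OF assms(1) * assms(5)]
    by blast
next
  assume "p \<in> K \<and> q \<in> K"
  then show "s *\<^sub>R \<epsilon> p + t *\<^sub>R \<epsilon> q \<in> span (\<epsilon> ` K)"
    by (intro span_add span_scale span_base imageI) simp_all
qed

subsection \<open>Blocks\<close>

text \<open>One half of the displayed set: the roots in the coordinate subspace of \<open>K\<close>,
  with short values cut down to \<open>Z\<close>. Membership in a span makes closure under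
  reflections and sums immediate; \<open>block_eq\<close> recovers the listing by indices.\<close>

definition block :: "nat set \<Rightarrow> 'y set \<Rightarrow> ('v \<times> 'y) set" where
  "block K Z = {(\<alpha>, y). \<alpha> \<in> R \<and> \<alpha> \<in> span (\<epsilon> ` K) \<and> y \<in> (if \<alpha> \<bullet> \<alpha> = 1 then Z else L)}"

lemma short_in_block_iff:
  assumes "K \<subseteq> {1..n}" "s \<in> sgns" "i \<in> {1..n}"
  shows "(s *\<^sub>R \<epsilon> i, z) \<in> block K Z \<longleftrightarrow> i \<in> K \<and> z \<in> Z"
  using assms
  by (simp add: block_def short_in_R short_in_span_iff inner_short del: insert_iff inner_scaleR_left inner_scaleR_right)

lemma long_in_block_iff:
  assumes "K \<subseteq> {1..n}" "s \<in> sgns" "t \<in> sgns" "p \<in> {1..n}" "q \<in> {1..n}" "p \<noteq> q"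
  shows "(s *\<^sub>R \<epsilon> p + t *\<^sub>R \<epsilon> q, y) \<in> block K Z \<longleftrightarrow> p \<in> K \<and> q \<in> K \<and> y \<in> L"
  unfolding block_def mem_Collect_eq case_prod_conv inner_long[OF assms(2-)]
    long_in_span_iff[OF assms] using long_in_R[OF assms(2-)] by auto

lemma block_subset: "Z \<subseteq> S \<Longrightarrow> block K Z \<subseteq> real_roots R \<Lambda>"
  by (auto simp: block_def real_roots_def Lambda_root split: if_splits)

lemma block_eq:
  assumes "K \<subseteq> {1..n}"
  shows "block K Z =
    {(s *\<^sub>R \<epsilon> i, z) | s i z. s \<in> sgns \<and> i \<in> K \<and> z \<in> Z} \<union>
    {(s *\<^sub>R \<epsilon> p + t *\<^sub>R \<epsilon> q, y) | s t p q y.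
       s \<in> sgns \<and> t \<in> sgns \<and> p \<in> K \<and> q \<in> K \<and> p \<noteq> q \<and> y \<in> L}" (is "_ = ?A \<union> ?B")
proof (intro subset_antisym subsetI)
  fix x assume x: "x \<in> block K Z"
  obtain \<alpha> y where xy: "x = (\<alpha>, y)" by (cases x)
  with x have "\<alpha> \<in> R" by (simp add: block_def)
  then show "x \<in> ?A \<union> ?B"
  proof (cases rule: root_cases)
    case (short s i)
    then show ?thesis using x xy short_in_block_iff[OF assms short(1,2)] by blast
  next
    case (long s t p q)
    then show ?thesis using x xy long_in_block_iff[OF assms long(1-5)] by blast
  qed
next
  fix x assume "x \<in> ?A \<union> ?B"
  then show "x \<in> block K Z"
  proof
    assume "x \<in> ?A"
    then show ?thesis using assms short_in_block_iff[OF assms] by blast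
  next
    assume "x \<in> ?B"
    then show ?thesis using assms long_in_block_iff[OF assms] by blast
  qed
qed

text \<open>A reflection keeps the length of a root and moves its value within an
  \<open>L\<close>-coset, and both \<open>Z\<close> and \<open>L\<close> are unions of such
  cosets.\<close>

lemma block_refl:
  assumes "Z \<subseteq> S" "union_of_cosets L Z" "a \<in> block K Z" "b \<in> block K Z"
  shows "affine_refl a b \<in> block K Z"
proof -
  obtain \<alpha> y \<beta> z where ab: "a = (\<alpha>, y)" "b = (\<beta>, z)" by (cases a, cases b)
  let ?w = "(\<beta> \<bullet> coroot \<alpha>) *\<^sub>R y"
  have r: "\<alpha> \<in> R" "\<beta> \<in> R" and sp: "\<alpha> \<in> span (\<epsilon> ` K)" "\<beta> \<in> span (\<epsilon> ` K)"
    and z: "z \<in> (if \<beta> \<bullet> \<beta> = 1 then Z else L)"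
    using assms ab by (auto simp: block_def)
  have "(\<alpha>, y) \<in> real_roots R \<Lambda>"
    using block_subset[OF assms(1)] assms(3) unfolding ab by blast
  then have "y \<in> \<Lambda> \<alpha>" by (simp add: real_roots_def)
  then have "- ?w \<in> L"
    using r by (intro uminus_L coroot_scale_in_L)
  then have "z + - ?w \<in> (if \<beta> \<bullet> \<beta> = 1 then Z else L)"
    using z assms(2) add_L unfolding union_of_cosets_iff[OF L_additive_subgroup]
    by (metis (full_types))
  moreover have "refl_root \<alpha> \<beta> \<in> span (\<epsilon> ` K)"
    using sp by (auto simp: refl_root_def intro: span_diff span_scale)
  ultimately show ?thesis
    using r by (simp add: ab block_def refl_root_closed inner_refl_root)
qed

text \<open>Parity of norm squares: short roots have norm square 1, long roots 2.\<close>

lemma short_sum: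
  assumes "\<alpha> \<in> R" "\<beta> \<in> R" "(\<alpha> + \<beta>) \<bullet> (\<alpha> + \<beta>) = 1"
  shows "(\<alpha> \<bullet> \<alpha> = 1) \<noteq> (\<beta> \<bullet> \<beta> = 1)"
proof -
  obtain m where m: "\<alpha> \<bullet> \<beta> = of_int m"
    using inner_roots_Ints[OF assms(1,2)] by (auto elim: Ints_cases)
  have eq: "\<alpha> \<bullet> \<alpha> + \<beta> \<bullet> \<beta> + 2 * of_int m = 1"
    using assms(3) m by (simp add: inner_add_left inner_add_right inner_commute)
  show ?thesis
  proof
    assume "(\<alpha> \<bullet> \<alpha> = 1) = (\<beta> \<bullet> \<beta> = 1)"
    then consider "\<alpha> \<bullet> \<alpha> = 1" "\<beta> \<bullet> \<beta> = 1" | "\<alpha> \<bullet> \<alpha> = 2" "\<beta> \<bullet> \<beta> = 2"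
      using inner_root_self assms by blast
    then show False
    proof cases
      case 1
      then have "real_of_int (2 + 2 * m) = of_int 1" using eq by simp
      then have "2 + 2 * m = 1" by (simp only: of_int_eq_iff)
      then show False by presburger
    next
      case 2
      then have "real_of_int (4 + 2 * m) = of_int 1" using eq by simp
      then have "4 + 2 * m = 1" by (simp only: of_int_eq_iff)
      then show False by presburger
    qed
  qed
qed

text \<open>If the sum is short, exactly one summand is short by parity, so the value lies in
  \<open>Z + L\<close>. If it is long, being a real root already puts the value in
  \<open>L\<close>.\<close>

lemma block_add:
  assumes "union_of_cosets L Z" "a \<in> block K Z" "b \<in> block K Z" "a + b \<in> real_roots R \<Lambda>"
  shows "a + b \<in> block K Z"
proof -
  obtain \<alpha> y \<beta> z where ab: "a = (\<alpha>, y)" "b = (\<beta>, z)" by (cases a, cases b)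
  have r: "\<alpha> \<in> R" "\<beta> \<in> R" and sp: "\<alpha> \<in> span (\<epsilon> ` K)" "\<beta> \<in> span (\<epsilon> ` K)"
    and y: "y \<in> (if \<alpha> \<bullet> \<alpha> = 1 then Z else L)"
    and z: "z \<in> (if \<beta> \<bullet> \<beta> = 1 then Z else L)"
    using assms ab by (auto simp: block_def)
  have sum: "\<alpha> + \<beta> \<in> R" "y + z \<in> \<Lambda> (\<alpha> + \<beta>)"
    using assms(4) ab by (auto simp: real_roots_def)
  have "y + z \<in> (if (\<alpha> + \<beta>) \<bullet> (\<alpha> + \<beta>) = 1 then Z else L)"
  proof (cases "(\<alpha> + \<beta>) \<bullet> (\<alpha> + \<beta>) = 1")
    case True
    have coset: "\<forall>z\<in>Z. \<forall>l\<in>L. z + l \<in> Z"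
      using assms(1) by (simp only: union_of_cosets_iff[OF L_additive_subgroup])
    have "(\<alpha> \<bullet> \<alpha> = 1) \<noteq> (\<beta> \<bullet> \<beta> = 1)" by (rule short_sum[OF r True])
    then have "(y \<in> Z \<and> z \<in> L) \<or> (z \<in> Z \<and> y \<in> L)" using y z by (auto split: if_splits)
    then have "y + z \<in> Z" using coset by (metis add.commute)
    then show ?thesis using True by simp
  next
    case False
    then show ?thesis using Lambda_root[OF sum(1)] sum(2) by simp
  qed
  then show ?thesis
    using sum(1) sp by (simp add: ab block_def span_add)
qed

text \<open>The data of the classification with \<open>K'\<close> as \<open>J\<close> and
  \<open>K\<close> as its complement, written symmetrically so that each argument about one half
  transfers to the other by \<open>split_pair_sym\<close>.\<close>

definition split_pair :: "nat set \<Rightarrow> 'y set \<Rightarrow> nat set \<Rightarrow> 'y set \<Rightarrow> bool" where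
  "split_pair K Z K' Z' \<longleftrightarrow>
     K \<noteq> {} \<and> K' \<noteq> {} \<and> K \<inter> K' = {} \<and> K \<union> K' = {1..n} \<and>
     Z \<noteq> {} \<and> Z' \<noteq> {} \<and> Z \<inter> Z' = {} \<and> Z \<union> Z' = S \<and>
     union_of_cosets L Z \<and> union_of_cosets L Z'"

lemma split_pair_sym: "split_pair K Z K' Z' \<Longrightarrow> split_pair K' Z' K Z"
  unfolding split_pair_def by blast

lemma split_pair_index: "split_pair K Z K' Z' \<Longrightarrow> K \<subseteq> {1..n}"
  unfolding split_pair_def by blast

lemma split_pair_translate:
  "split_pair K Z K' Z' \<Longrightarrow> z \<in> Z \<Longrightarrow> w - z \<in> L \<Longrightarrow> w \<in> Z"
  unfolding split_pair_def using union_of_cosets_translate[OF L_additive_subgroup] by blast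

text \<open>The elements \<open>z\<close> and \<open>- z\<close> differ by \<open>2z\<close>, which
  lies in \<open>L\<close>.\<close>

lemma split_pair_uminus:
  assumes "split_pair K Z K' Z'" "z \<in> Z"
  shows "- z \<in> Z"
proof (rule split_pair_translate[OF assms])
  have "z \<in> S" using assms by (auto simp: split_pair_def)
  then have "- (2 *\<^sub>R z) \<in> L" by (intro uminus_L double_S)
  then show "- z - z \<in> L" by (simp add: scaleR_2)
qed

lemma cross_block_refl:
  assumes "split_pair K Z K' Z'" "a \<in> block K Z" "b \<in> block K' Z'"
  shows "affine_refl a b = b"
proof -
  obtain \<alpha> y \<beta> z where ab: "a = (\<alpha>, y)" "b = (\<beta>, z)" by (cases a, cases b)
  have "\<beta> \<bullet> \<alpha> = 0"
    using assms ab by (intro orthogonal_spans[of K' K]) (auto simp: split_pair_def block_def)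
  then show ?thesis by (simp add: ab refl_root_def inner_coroot)
qed

text \<open>By orthogonality the norm squares add, and all three lie in {1, 2}; only 1 + 1 = 2 is
  possible.\<close>

lemma cross_root_sum:
  assumes "K \<subseteq> {1..n}" "K' \<subseteq> {1..n}" "K \<inter> K' = {}"
    and "\<alpha> \<in> R" "\<beta> \<in> R" "\<alpha> \<in> span (\<epsilon> ` K)" "\<beta> \<in> span (\<epsilon> ` K')" "\<alpha> + \<beta> \<in> R"
  shows "\<alpha> \<bullet> \<alpha> = 1" "\<beta> \<bullet> \<beta> = 1" "(\<alpha> + \<beta>) \<bullet> (\<alpha> + \<beta>) = 2"
proof -
  have "\<alpha> \<bullet> \<beta> = 0" by (rule orthogonal_spans[OF assms(1-3,6,7)])
  then have "(\<alpha> + \<beta>) \<bullet> (\<alpha> + \<beta>) = \<alpha> \<bullet> \<alpha> + \<beta> \<bullet> \<beta>"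
    by (simp add: inner_add_left inner_add_right inner_commute)
  then show "\<alpha> \<bullet> \<alpha> = 1" "\<beta> \<bullet> \<beta> = 1" "(\<alpha> + \<beta>) \<bullet> (\<alpha> + \<beta>) = 2"
    using inner_root_self[OF assms(4)] inner_root_self[OF assms(5)] inner_root_self[OF assms(8)] by auto
qed

text \<open>Such a sum would be long, so \<open>y + z \<in> L\<close>; then \<open>z\<close> is in
  the coset of \<open>- y\<close>, which belongs to \<open>Z\<close>, against disjointness.\<close>

lemma cross_block_add:
  assumes sp: "split_pair K Z K' Z'" and a: "a \<in> block K Z" and b: "b \<in> block K' Z'"
  shows "a + b \<notin> real_roots R \<Lambda>"
proof
  assume sum: "a + b \<in> real_roots R \<Lambda>"
  obtain \<alpha> y \<beta> z where ab: "a = (\<alpha>, y)" "b = (\<beta>, z)" by (cases a, cases b)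
  have r: "\<alpha> \<in> R" "\<beta> \<in> R" "\<alpha> \<in> span (\<epsilon> ` K)" "\<beta> \<in> span (\<epsilon> ` K')" "\<alpha> + \<beta> \<in> R"
    using a b sum ab by (auto simp: block_def real_roots_def)
  have K: "K \<subseteq> {1..n}" "K' \<subseteq> {1..n}" "K \<inter> K' = {}" using sp by (auto simp: split_pair_def)
  note c = cross_root_sum[OF K r]
  have y: "y \<in> Z" and z: "z \<in> Z'" and "y + z \<in> L"
    using a b sum ab c Lambda_root[OF r(5)] by (auto simp: block_def real_roots_def)
  then have "z - (- y) \<in> L" by (simp add: add.commute)
  then have "z \<in> Z" using split_pair_translate[OF sp split_pair_uminus[OF sp y]] by blast
  then show False using z sp by (auto simp: split_pair_def)
qed

lemma split_pair_closed:
  assumes sp: "split_pair K Z K' Z'"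
  shows "closed_subroot_system R \<Lambda> (block K Z \<union> block K' Z')"
proof -
  note sp' = split_pair_sym[OF sp]
  let ?P = "block K Z \<union> block K' Z'"
  have K: "K \<subseteq> {1..n}" "K' \<subseteq> {1..n}" and Z: "Z \<subseteq> S" "Z' \<subseteq> S"
    and U: "union_of_cosets L Z" "union_of_cosets L Z'" and d: "K \<inter> K' = {}"
    using sp by (auto simp: split_pair_def)
  obtain i j z where ij: "i \<in> K" "j \<in> K'" "z \<in> Z" using sp by (auto simp: split_pair_def)
  have ne: "i \<noteq> j" "i \<notin> K'" "j \<notin> K" and ijn: "i \<in> {1..n}" "j \<in> {1..n}" using ij d K by auto
  have "(1 *\<^sub>R \<epsilon> i, z) \<in> ?P" using short_in_block_iff[OF K(1), of 1 i] ij ijn by simp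
  then have "?P \<noteq> {}" by blast
  moreover have "?P \<subseteq> real_roots R \<Lambda>" using block_subset Z by blast
  \<comment> \<open>A long root joining the two index sets witnesses that the union of the blocks is
    proper.\<close>
  moreover have "(1 *\<^sub>R \<epsilon> i + 1 *\<^sub>R \<epsilon> j, 0) \<notin> ?P"
    using long_in_block_iff[OF K(1), of 1 1 i j] long_in_block_iff[OF K(2), of 1 1 i j] ne ijn by simp
  moreover have "(1 *\<^sub>R \<epsilon> i + 1 *\<^sub>R \<epsilon> j, 0) \<in> real_roots R \<Lambda>"
    using long_in_R[of 1 1 i j] ne ijn zero_in_Lambda by (auto simp: real_roots_def)
  moreover have "affine_refl a b \<in> ?P" if "a \<in> ?P" "b \<in> ?P" for a b
    using that block_refl Z U cross_block_refl[OF sp] cross_block_refl[OF sp'] by (metis UnE UnI1 UnI2)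
  moreover have "a + b \<in> ?P" if "a \<in> ?P" "b \<in> ?P" "a + b \<in> real_roots R \<Lambda>" for a b
    using that block_add U cross_block_add[OF sp] cross_block_add[OF sp'] by (metis UnE UnI1 UnI2)
  ultimately show ?thesis
    unfolding closed_subroot_system_def subroot_system_def by blast
qed

subsection \<open>Maximality\<close>

text \<open>The values missing at \<open>K\<close> are those in \<open>Z'\<close>. Reflection in the
  mixed long root exchanges the axes \<open>i\<close> and \<open>j\<close> up to sign, carrying
  \<open>Z'\<close>-values from \<open>j\<close> to \<open>i\<close>; long roots inside the block of
  \<open>K\<close> then carry them from \<open>i\<close> to \<open>k\<close>.\<close>

lemma mixed_long_root_fills_short:
  assumes sp: "split_pair K Z K' Z'" and cl: "closed_subroot_system R \<Lambda> \<Phi>"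
    and sub: "block K Z \<union> block K' Z' \<subseteq> \<Phi>"
    and st: "s \<in> sgns" "t \<in> sgns" and ij: "i \<in> K" "j \<in> K'"
    and mem: "(s *\<^sub>R \<epsilon> i + t *\<^sub>R \<epsilon> j, y) \<in> \<Phi>"
    and u: "u \<in> sgns" and k: "k \<in> K" and z: "z \<in> S"
  shows "(u *\<^sub>R \<epsilon> k, z) \<in> \<Phi>"
proof (cases "z \<in> Z")
  case True
  then show ?thesis
    using sub short_in_block_iff[OF split_pair_index[OF sp] u, of k z Z] k split_pair_index[OF sp] by blast
next
  case False
  then have z: "z \<in> Z'" using z sp by (auto simp: split_pair_def)
  have K: "K \<subseteq> {1..n}" "K' \<subseteq> {1..n}" using sp by (auto simp: split_pair_def)
  have n: "i \<in> {1..n}" "j \<in> {1..n}" "k \<in> {1..n}" "i \<noteq> j" using ij k sp by (auto simp: split_pair_def)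
  have refl: "affine_refl a b \<in> \<Phi>" if "a \<in> \<Phi>" "b \<in> \<Phi>" for a b
    using cl that unfolding closed_subroot_system_def subroot_system_def by blast
  have "(s *\<^sub>R \<epsilon> i + t *\<^sub>R \<epsilon> j, y) \<in> real_roots R \<Lambda>"
    using cl mem unfolding closed_subroot_system_def subroot_system_def by blast
  then have y: "y \<in> L" using Lambda_long_root[OF st n(1,2,4)] by (auto simp: real_roots_def)
  \<comment> \<open>The reflection sends \<open>v *\<^sub>R \<epsilon> j\<close> to
    \<open>- (v * s * t) *\<^sub>R \<epsilon> i\<close>, which this sign turns into
    \<open>u *\<^sub>R \<epsilon> i\<close>. It also subtracts \<open>(v * t) *\<^sub>R y\<close>
    from the value, so that amount is added to \<open>z\<close> beforehand, inside its
    coset.\<close>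
  define v where "v = - (u * s * t)"
  have v: "v \<in> sgns" using st u by (auto simp: v_def)
  have vt: "v * t \<in> \<int>" using v st by auto
  have "(v * t) *\<^sub>R y \<in> L" by (rule additive_subgroup_scale_int[OF L_additive_subgroup y vt])
  then have "z + (v * t) *\<^sub>R y \<in> Z'"
    using split_pair_translate[OF split_pair_sym[OF sp] z] by simp
  then have "(v *\<^sub>R \<epsilon> j, z + (v * t) *\<^sub>R y) \<in> \<Phi>"
    using sub short_in_block_iff[OF K(2) v n(2)] ij by blast
  from refl[OF mem this]
  have "(refl_root (s *\<^sub>R \<epsilon> i + t *\<^sub>R \<epsilon> j) (v *\<^sub>R \<epsilon> j),
      z + (v * t) *\<^sub>R y - (v *\<^sub>R \<epsilon> j \<bullet> coroot (s *\<^sub>R \<epsilon> i + t *\<^sub>R \<epsilon> j)) *\<^sub>R y) \<in> \<Phi>" by simp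
  moreover have "v *\<^sub>R \<epsilon> j \<bullet> coroot (s *\<^sub>R \<epsilon> i + t *\<^sub>R \<epsilon> j) = v * t"
    unfolding inner_coroot inner_long[OF st n(1,2,4)] using n by (simp add: inner_add_right inner_basis)
  moreover have "refl_root (s *\<^sub>R \<epsilon> i + t *\<^sub>R \<epsilon> j) (v *\<^sub>R \<epsilon> j) = u *\<^sub>R \<epsilon> i"
    unfolding refl_long[OF st n(1,2,4)] using n st u
    by (auto simp: inner_add_right inner_basis v_def)
  ultimately have "(u *\<^sub>R \<epsilon> i, z + (v * t) *\<^sub>R y - (v * t) *\<^sub>R y) \<in> \<Phi>" by (simp only:)
  then have base: "(u *\<^sub>R \<epsilon> i, z) \<in> \<Phi>" by simp
  show ?thesis
  proof (cases "k = i")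
    case False
    then have ik: "i \<noteq> k" by simp
    have "(1 *\<^sub>R \<epsilon> i + (-1) *\<^sub>R \<epsilon> k, 0) \<in> \<Phi>"
      using sub long_in_block_iff[OF K(1) _ _ n(1,3) ik, of 1 "-1" 0 Z] ij k zero_L
      by (simp add: subset_iff)
    from refl[OF this base]
    have "(refl_root (1 *\<^sub>R \<epsilon> i + (-1) *\<^sub>R \<epsilon> k) (u *\<^sub>R \<epsilon> i), z) \<in> \<Phi>"
      by (simp only: affine_refl.simps scaleR_zero_right diff_zero)
    moreover have "refl_root (1 *\<^sub>R \<epsilon> i + (-1) *\<^sub>R \<epsilon> k) (u *\<^sub>R \<epsilon> i) = u *\<^sub>R \<epsilon> k"
      using n ik by (subst refl_long) (auto simp: inner_add_right inner_diff_right inner_basis algebra_simps)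
    ultimately show ?thesis by (simp only:)
  qed (use base in simp)
qed

text \<open>Filling both halves gives all short real roots. As \<open>L \<subseteq> S\<close>, a
  long root of value \<open>w\<close> is then a sum of two short ones with values 0 and
  \<open>w\<close>.\<close>

lemma mixed_long_root_generates:
  assumes sp: "split_pair K Z K' Z'" and cl: "closed_subroot_system R \<Lambda> \<Phi>"
    and sub: "block K Z \<union> block K' Z' \<subseteq> \<Phi>"
    and st: "s \<in> sgns" "t \<in> sgns" and ij: "i \<in> K" "j \<in> K'"
    and mem: "(s *\<^sub>R \<epsilon> i + t *\<^sub>R \<epsilon> j, y) \<in> \<Phi>"
  shows "\<Phi> = real_roots R \<Lambda>"
proof
  show "\<Phi> \<subseteq> real_roots R \<Lambda>"
    using cl unfolding closed_subroot_system_def subroot_system_def by blast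
  have fill: "(u *\<^sub>R \<epsilon> k, z) \<in> \<Phi>" if u: "u \<in> sgns" and k: "k \<in> {1..n}" and z: "z \<in> S" for u k z
  proof -
    have "k \<in> K \<or> k \<in> K'" using k sp by (auto simp: split_pair_def)
    then show ?thesis
    proof
      assume "k \<in> K"
      from mixed_long_root_fills_short[OF sp cl sub st ij mem u this z] show ?thesis .
    next
      assume k: "k \<in> K'"
      have sub': "block K' Z' \<union> block K Z \<subseteq> \<Phi>" using sub by blast
      have mem': "(t *\<^sub>R \<epsilon> j + s *\<^sub>R \<epsilon> i, y) \<in> \<Phi>" using mem by (simp add: add.commute)
      from mixed_long_root_fills_short[OF split_pair_sym[OF sp] cl sub' st(2,1) ij(2,1) mem' u k z]
      show ?thesis .
    qed
  qed
  show "real_roots R \<Lambda> \<subseteq> \<Phi>"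
  proof
    fix x assume x: "x \<in> real_roots R \<Lambda>"
    then obtain \<alpha> w where xw: "x = (\<alpha>, w)" "\<alpha> \<in> R" "w \<in> \<Lambda> \<alpha>" by (auto simp: real_roots_def)
    from xw(2) show "x \<in> \<Phi>"
    proof (cases rule: root_cases)
      case (short s i)
      have "w \<in> S" using xw(3) unfolding short(3) Lambda_short_root[OF short(1,2)] .
      then show ?thesis unfolding xw(1) short(3) by (rule fill[OF short(1,2)])
    next
      case (long s t p q)
      have "w \<in> L" using xw(3) unfolding long(6) Lambda_long_root[OF long(1-5)] .
      then have "w \<in> S" using L_subset_S by blast
      have "(s *\<^sub>R \<epsilon> p, 0) \<in> \<Phi>" "(t *\<^sub>R \<epsilon> q, w) \<in> \<Phi>"
        using fill[OF long(1,3) zero_S] fill[OF long(2,4) \<open>w \<in> S\<close>] .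
      moreover have "(s *\<^sub>R \<epsilon> p, 0) + (t *\<^sub>R \<epsilon> q, w) = x" using xw long by simp
      ultimately show ?thesis
        using cl x unfolding closed_subroot_system_def by metis
    qed
  qed
qed

text \<open>Adding the short root at \<open>j\<close> of value \<open>- z\<close>, available because
  \<open>Z'\<close> is stable under negation, produces a mixed long root of value 0.\<close>

lemma foreign_short_root_generates:
  assumes sp: "split_pair K Z K' Z'" and cl: "closed_subroot_system R \<Lambda> \<Phi>"
    and sub: "block K Z \<union> block K' Z' \<subseteq> \<Phi>"
    and s: "s \<in> sgns" and i: "i \<in> K" and z: "z \<in> Z'"
    and mem: "(s *\<^sub>R \<epsilon> i, z) \<in> \<Phi>"
  shows "\<Phi> = real_roots R \<Lambda>"
proof -
  obtain j where j: "j \<in> K'" using sp by (auto simp: split_pair_def)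
  have K: "K' \<subseteq> {1..n}" and n: "i \<in> {1..n}" "j \<in> {1..n}" "i \<noteq> j"
    using i j sp by (auto simp: split_pair_def)
  have one: "1 \<in> sgns" by simp
  have "- z \<in> Z'" by (rule split_pair_uminus[OF split_pair_sym[OF sp] z])
  then have "(1 *\<^sub>R \<epsilon> j, - z) \<in> \<Phi>"
    using sub short_in_block_iff[OF K one n(2)] j by blast
  moreover have "(s *\<^sub>R \<epsilon> i, z) + (1 *\<^sub>R \<epsilon> j, - z) = (s *\<^sub>R \<epsilon> i + 1 *\<^sub>R \<epsilon> j, 0)" by simp
  moreover have "(s *\<^sub>R \<epsilon> i + 1 *\<^sub>R \<epsilon> j, 0) \<in> real_roots R \<Lambda>"
    using long_in_R[OF s one n] zero_in_Lambda by (auto simp: real_roots_def)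
  ultimately have "(s *\<^sub>R \<epsilon> i + 1 *\<^sub>R \<epsilon> j, 0) \<in> \<Phi>"
    using cl mem unfolding closed_subroot_system_def by metis
  then show ?thesis by (rule mixed_long_root_generates[OF sp cl sub s one i j])
qed

text \<open>A real root outside both blocks is either short with its value in the wrong part of
  \<open>S\<close>, or long with indices in different halves; the two preceding lemmas treat these
  cases.\<close>

lemma split_pair_maximal:
  assumes sp: "split_pair K Z K' Z'"
  shows "maximal_closed_subroot_system R \<Lambda> (block K Z \<union> block K' Z')"
proof -
  let ?P = "block K Z \<union> block K' Z'"
  have K: "K \<subseteq> {1..n}" "K' \<subseteq> {1..n}" using sp by (auto simp: split_pair_def)
  have "\<Phi> = real_roots R \<Lambda>"
    if cl: "closed_subroot_system R \<Lambda> \<Phi>" and lt: "?P \<subset> \<Phi>" for \<Phi>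
  proof -
    have sub: "?P \<subseteq> \<Phi>" and sub': "block K' Z' \<union> block K Z \<subseteq> \<Phi>" using lt by auto
    note short1 = foreign_short_root_generates[OF sp cl sub]
      and short2 = foreign_short_root_generates[OF split_pair_sym[OF sp] cl sub']
      and long1 = mixed_long_root_generates[OF sp cl sub]
      and long2 = mixed_long_root_generates[OF split_pair_sym[OF sp] cl sub']
    obtain \<alpha> y where x: "(\<alpha>, y) \<in> \<Phi>" "(\<alpha>, y) \<notin> ?P" using lt by auto
    have r: "\<alpha> \<in> R" "y \<in> \<Lambda> \<alpha>"
      using x(1) cl by (auto simp: closed_subroot_system_def subroot_system_def real_roots_def)
    from r(1) show ?thesis
    proof (cases rule: root_cases)
      case (short s i)
      have "y \<in> Z \<or> y \<in> Z'" "i \<in> K \<or> i \<in> K'"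
        using r(2) sp short Lambda_short_root[OF short(1,2)] by (auto simp: split_pair_def)
      moreover note x[unfolded short(3) Un_iff short_in_block_iff[OF K(1) short(1,2)]
        short_in_block_iff[OF K(2) short(1,2)]]
      ultimately show ?thesis
        using short1[OF short(1)] short2[OF short(1)] by blast
    next
      case (long s t p q)
      have "y \<in> L" using r(2) Lambda_long_root[OF long(1-5)] long(6) by simp
      moreover have "p \<in> K \<or> p \<in> K'" "q \<in> K \<or> q \<in> K'"
        using long sp by (auto simp: split_pair_def)
      moreover note x[unfolded long(6) Un_iff long_in_block_iff[OF K(1) long(1-5)]
        long_in_block_iff[OF K(2) long(1-5)]]
      ultimately show ?thesis
        using long1[OF long(1,2)] long2[OF long(1,2)] by blast
    qed
  qed
  then show ?thesis
    using split_pair_closed[OF sp] unfolding maximal_closed_subroot_system_def by blast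
qed

section \<open>Semi-closedness of the gradient of two blocks\<close>

lemma gradient_blocks:
  assumes sp: "split_pair K Z K' Z'"
  shows "gradient R \<Lambda> (block K Z \<union> block K' Z') = R \<inter> (span (\<epsilon> ` K) \<union> span (\<epsilon> ` K'))"
proof -
  have "Z \<subseteq> S" "Z' \<subseteq> S" using sp by (auto simp: split_pair_def)
  then have sub: "block K Z \<union> block K' Z' \<subseteq> real_roots R \<Lambda>" using block_subset by blast
  have ex: "(\<exists>y. (\<alpha>, y) \<in> block H W) \<longleftrightarrow> \<alpha> \<in> R \<and> \<alpha> \<in> span (\<epsilon> ` H)" if "W \<noteq> {}" for \<alpha> H W
  proof -
    \<comment> \<open>Nonemptiness of \<open>W\<close> and \<open>0 \<in> L\<close> make every root
      of the subspace occur in the gradient.\<close>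
    have "\<exists>y. y \<in> (if \<alpha> \<bullet> \<alpha> = 1 then W else L)" using that zero_L by (simp, blast)
    then show ?thesis by (simp only: block_def mem_Collect_eq case_prod_conv) blast
  qed
  have "Z \<noteq> {}" "Z' \<noteq> {}" using sp by (auto simp: split_pair_def)
  from ex[OF this(1)] ex[OF this(2)] show ?thesis
    unfolding set_eq_iff gradient_iff[OF sub] by blast
qed

text \<open>Each coordinate subspace is closed under addition, so a sum leaving the gradient has one
  summand in each; \<open>cross_root_sum\<close> then determines the lengths. The sum
  \<open>\<epsilon> i + \<epsilon> j\<close> across the halves shows that this does happen.\<close>

lemma split_pair_semi_closed:
  assumes sp: "split_pair K Z K' Z'"
  shows "semi_closed_roots R (gradient R \<Lambda> (block K Z \<union> block K' Z'))" (is "semi_closed_roots R ?G")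
proof -
  have K: "K \<subseteq> {1..n}" "K' \<subseteq> {1..n}" and d: "K \<inter> K' = {}" "K' \<inter> K = {}"
    using sp by (auto simp: split_pair_def)
  have stable: "reflection_stable R ?G"
    using split_pair_closed[OF sp] by (intro reflection_stable_gradient) (simp add: closed_subroot_system_def)
  obtain i j where ij: "i \<in> K" "j \<in> K'" using sp by (auto simp: split_pair_def)
  then have n: "i \<in> {1..n}" "j \<in> {1..n}" "i \<noteq> j" and ji: "j \<notin> K" "i \<notin> K'" using K d by auto
  have one: "(1::real) \<in> sgns" by simp
  have "1 *\<^sub>R \<epsilon> i \<in> ?G" "1 *\<^sub>R \<epsilon> j \<in> ?G"
    using ij short_in_R[OF one n(1)] short_in_R[OF one n(2)]
      short_in_span_iff[OF K(1) one n(1)] short_in_span_iff[OF K(2) one n(2)]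
    by (simp_all only: gradient_blocks[OF sp]) blast+
  moreover have "1 *\<^sub>R \<epsilon> i + 1 *\<^sub>R \<epsilon> j \<notin> ?G"
    using ji long_in_span_iff[OF K(1) one one n] long_in_span_iff[OF K(2) one one n]
    by (simp only: gradient_blocks[OF sp]) blast
  ultimately have "\<not> closed_roots R ?G"
    using long_in_R[OF one one n] unfolding closed_roots_def by blast
  moreover have "\<alpha> \<in> short_roots R \<and> \<beta> \<in> short_roots R \<and> \<alpha> + \<beta> \<in> long_roots R"
    if h: "\<alpha> \<in> ?G" "\<beta> \<in> ?G" "\<alpha> + \<beta> \<in> R - ?G" for \<alpha> \<beta>
  proof -
    have r: "\<alpha> \<in> R" "\<beta> \<in> R" "\<alpha> + \<beta> \<in> R" using h by (auto simp: gradient_def)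
    have "\<alpha> \<in> span (\<epsilon> ` K) \<and> \<beta> \<in> span (\<epsilon> ` K') \<or> \<alpha> \<in> span (\<epsilon> ` K') \<and> \<beta> \<in> span (\<epsilon> ` K)"
      using h span_add by (auto simp: gradient_blocks[OF sp])
    then have "\<alpha> \<bullet> \<alpha> = 1 \<and> \<beta> \<bullet> \<beta> = 1 \<and> (\<alpha> + \<beta>) \<bullet> (\<alpha> + \<beta>) = 2"
      using cross_root_sum[OF K d(1) r(1,2) _ _ r(3)] cross_root_sum[OF K(2,1) d(2) r(1,2) _ _ r(3)]
      by blast
    then show ?thesis using r by (simp add: short_roots_R long_roots_R)
  qed
  ultimately show ?thesis
    using stable unfolding semi_closed_roots_def by blast
qed

subsection \<open>Semi-closed gradients\<close>

lemma semi_closed_maximal_imp_split: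
  assumes max: "maximal_closed_subroot_system R \<Lambda> \<Psi>"
    and semi: "semi_closed_roots R (gradient R \<Lambda> \<Psi>)"
  shows "\<exists>K Z K' Z'. split_pair K Z K' Z' \<and> \<Psi> = block K Z \<union> block K' Z'"
proof -
  let ?G = "gradient R \<Lambda> \<Psi>"
  have cl: "closed_subroot_system R \<Lambda> \<Psi>"
    using max by (simp add: maximal_closed_subroot_system_def)
  then have sub: "\<Psi> \<subseteq> real_roots R \<Lambda>" and refl: "\<And>a b. a \<in> \<Psi> \<Longrightarrow> b \<in> \<Psi> \<Longrightarrow> affine_refl a b \<in> \<Psi>"
    and add: "\<And>a b. a \<in> \<Psi> \<Longrightarrow> b \<in> \<Psi> \<Longrightarrow> a + b \<in> real_roots R \<Lambda> \<Longrightarrow> a + b \<in> \<Psi>"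
    unfolding closed_subroot_system_def subroot_system_def by blast+
  have reflG: "refl_root \<alpha> \<beta> \<in> ?G" if "\<alpha> \<in> ?G" "\<beta> \<in> ?G" for \<alpha> \<beta>
    using semi that unfolding semi_closed_roots_def reflection_stable_def by blast
  \<comment> \<open>The gradient is reflection stable, so failure of closedness must come from a
    sum; semi-closedness then fixes the three lengths.\<close>
  obtain \<alpha> \<beta> where ab: "\<alpha> \<in> ?G" "\<beta> \<in> ?G" "\<alpha> + \<beta> \<in> R" "\<alpha> + \<beta> \<notin> ?G"
    using semi unfolding semi_closed_roots_def closed_roots_def by blast
  then have len: "\<alpha> \<bullet> \<alpha> = 1" "\<beta> \<bullet> \<beta> = 1" "(\<alpha> + \<beta>) \<bullet> (\<alpha> + \<beta>) = 2"
    using semi unfolding semi_closed_roots_def short_roots_R long_roots_R by blast+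
  have short_form: "\<exists>s i. s \<in> sgns \<and> i \<in> {1..n} \<and> \<gamma> = s *\<^sub>R \<epsilon> i" if "\<gamma> \<in> R" "\<gamma> \<bullet> \<gamma> = 1" for \<gamma>
    using that(1)
  proof (cases rule: root_cases)
    case (long s t p q)
    then show ?thesis using that(2) inner_long[OF long(1-5)] by simp
  qed blast
  obtain s i where i: "s \<in> sgns" "i \<in> {1..n}" "\<alpha> = s *\<^sub>R \<epsilon> i"
    using short_form len(1) ab(1) gradient_subset by blast
  obtain t j where j: "t \<in> sgns" "j \<in> {1..n}" "\<beta> = t *\<^sub>R \<epsilon> j"
    using short_form len(2) ab(2) gradient_subset by blast
  \<comment> \<open>Equal indices would give the sum norm square 0 or 4 instead of 2.\<close>
  have ij: "i \<noteq> j"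
  proof
    assume "i = j"
    then have "(\<alpha> + \<beta>) \<bullet> (\<alpha> + \<beta>) = (s + t) * (s + t)"
      using i j by (simp add: inner_basis flip: scaleR_add_left)
    then show False using len(3) i(1) j(1) by auto
  qed
  \<comment> \<open>Only indices linked to \<open>j\<close> by a single long root are collected;
    \<open>step\<close> shows that longer chains reach nothing new.\<close>
  define J where "J = {k \<in> {1..n}. k = j \<or> (\<exists>s\<in>sgns. \<exists>t\<in>sgns. s *\<^sub>R \<epsilon> j + t *\<^sub>R \<epsilon> k \<in> ?G)}"
  have Jn: "J \<subseteq> {1..n}" and jJ: "j \<in> J" using j by (auto simp: J_def)
  \<comment> \<open>If some signed combination of \<open>\<epsilon> j\<close> and
    \<open>\<epsilon> i\<close> were in the gradient, the reflections in \<alpha> and \<beta> would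
    adjust its signs to give \<alpha> + \<beta>.\<close>
  have iJ: "i \<notin> J"
  proof
    assume "i \<in> J"
    then obtain u v where uv: "u \<in> sgns" "v \<in> sgns" "u *\<^sub>R \<epsilon> j + v *\<^sub>R \<epsilon> i \<in> ?G"
      using ij unfolding J_def by blast
    have flipi: "u *\<^sub>R \<epsilon> j + (- v) *\<^sub>R \<epsilon> i \<in> ?G" if "u *\<^sub>R \<epsilon> j + v *\<^sub>R \<epsilon> i \<in> ?G" for u v
      using reflG[OF ab(1) that] unfolding i(3) flip_sign[OF i(1,2) j(2) ij] .
    have flipj: "(- u) *\<^sub>R \<epsilon> j + v *\<^sub>R \<epsilon> i \<in> ?G" if "u *\<^sub>R \<epsilon> j + v *\<^sub>R \<epsilon> i \<in> ?G" for u v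
    proof -
      have "v *\<^sub>R \<epsilon> i + u *\<^sub>R \<epsilon> j \<in> ?G" using that by (simp only: add.commute)
      from reflG[OF ab(2) this] show ?thesis
        unfolding j(3) flip_sign[OF j(1,2) i(2) ij[symmetric]] by (simp only: add.commute)
    qed
    have "t = u \<or> t = - u" "s = v \<or> s = - v" using uv i j by auto
    then have "t *\<^sub>R \<epsilon> j + s *\<^sub>R \<epsilon> i \<in> ?G"
      using uv(3) flipi flipj by metis
    then show False using ab(4) i j by (simp add: add.commute)
  qed
  \<comment> \<open>Reflecting the root that links \<open>j\<close> to \<open>p\<close> in the root
    that links \<open>p\<close> to \<open>q\<close> yields one linking \<open>j\<close> to
    \<open>q\<close>.\<close>
  have step: "q \<in> J"
    if g: "u *\<^sub>R \<epsilon> p + v *\<^sub>R \<epsilon> q \<in> ?G" and uv: "u \<in> sgns" "v \<in> sgns"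
      and pq: "p \<in> {1..n}" "q \<in> {1..n}" "p \<noteq> q" and p: "p \<in> J" for u v p q
  proof (cases "p = j \<or> q = j")
    case True
    then show ?thesis using g uv pq jJ unfolding J_def by blast
  next
    case False
    then obtain u' v' where u'v': "u' \<in> sgns" "v' \<in> sgns" "u' *\<^sub>R \<epsilon> j + v' *\<^sub>R \<epsilon> p \<in> ?G"
      using p unfolding J_def by blast
    have "refl_root (u *\<^sub>R \<epsilon> p + v *\<^sub>R \<epsilon> q) (u' *\<^sub>R \<epsilon> j + v' *\<^sub>R \<epsilon> p) = u' *\<^sub>R \<epsilon> j + (- (v' * u * v)) *\<^sub>R \<epsilon> q"
    proof -
      have uu: "v' * u * u = v'" using uv(1) by auto
      have inner: "(u' *\<^sub>R \<epsilon> j + v' *\<^sub>R \<epsilon> p) \<bullet> (u *\<^sub>R \<epsilon> p + v *\<^sub>R \<epsilon> q) = v' * u"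
        using pq j(2) False by (simp add: inner_add_left inner_add_right inner_basis)
      show ?thesis
        unfolding refl_long[OF uv pq] inner scaleR_add_right scaleR_scaleR uu scaleR_minus_left
        by simp
    qed
    then have "u' *\<^sub>R \<epsilon> j + (- (v' * u * v)) *\<^sub>R \<epsilon> q \<in> ?G"
      using reflG[OF g u'v'(3)] by simp
    moreover have "- (v' * u * v) \<in> sgns" using uv u'v' by auto
    ultimately show ?thesis using pq u'v'(1) unfolding J_def by blast
  qed
  \<comment> \<open>Saturating by \<open>L\<close> and then taking the complement in
    \<open>S\<close> secures the coset and covering conditions. The real content is
    \<open>in_Z\<close>: values over indices outside \<open>J\<close> avoid
    \<open>Z'\<close>.\<close>
  define Z' where "Z' = {y + l | y l. l \<in> L \<and> (\<exists>k\<in>J. \<exists>s\<in>sgns. (s *\<^sub>R \<epsilon> k, y) \<in> \<Psi>)}"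
  define Z where "Z = S - Z'"
  define K where "K = {1..n} - J"
  have short_S: "y \<in> S" if "(s *\<^sub>R \<epsilon> k, y) \<in> \<Psi>" "s \<in> sgns" "k \<in> {1..n}" for s k y
    using that sub Lambda_short_root[OF that(2,3)] by (auto simp: real_roots_def)
  have Z'S: "Z' \<subseteq> S"
    using short_S S_add_L Jn unfolding Z'_def by blast
  have Z'L: "w + l \<in> Z'" if w: "w \<in> Z'" and l: "l \<in> L" for w l
  proof -
    obtain y l' where y: "w = y + l'" "l' \<in> L" "\<exists>k\<in>J. \<exists>s\<in>sgns. (s *\<^sub>R \<epsilon> k, y) \<in> \<Psi>"
      using w unfolding Z'_def by blast
    have "w + l = y + (l' + l)" "l' + l \<in> L"
      using y add_L l by (simp_all add: add.assoc)
    then show ?thesis using y(3) unfolding Z'_def by blast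
  qed
  have ZL: "w + l \<in> Z" if "w \<in> Z" "l \<in> L" for w l
  proof -
    have "w + l \<notin> Z'"
    proof
      assume "w + l \<in> Z'"
      from Z'L[OF this uminus_L[OF that(2)]] have "w \<in> Z'" by simp
      then show False using that by (simp add: Z_def)
    qed
    then show ?thesis using S_add_L that by (simp add: Z_def)
  qed
  have in_Z': "y \<in> Z'" if "(s *\<^sub>R \<epsilon> k, y) \<in> \<Psi>" "s \<in> sgns" "k \<in> J" for s k y
  proof -
    have "y = y + 0" by simp
    with zero_L that show ?thesis unfolding Z'_def by blast
  qed
  \<comment> \<open>If values over \<open>m \<in> J\<close> and over \<open>k\<close> shared a
    coset, negating the first root by its own reflection and adding the second would give a long
    root with value in \<open>L\<close>, linking \<open>m\<close> to \<open>k\<close> and forcing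
    \<open>k \<in> J\<close>.\<close>
  have in_Z: "y \<in> Z" if y: "(s *\<^sub>R \<epsilon> k, y) \<in> \<Psi>" and s: "s \<in> sgns" and k: "k \<in> {1..n} - J" for s k y
  proof -
    have "y \<notin> Z'"
    proof
      assume "y \<in> Z'"
      then obtain w l m u where w: "y = w + l" "l \<in> L" "m \<in> J" "u \<in> sgns" "(u *\<^sub>R \<epsilon> m, w) \<in> \<Psi>"
        unfolding Z'_def by blast
      have m: "m \<in> {1..n}" "k \<noteq> m" "k \<in> {1..n}" using w(3) Jn k by blast+
      have mu: "- u \<in> sgns" using w(4) by auto
      have "affine_refl (u *\<^sub>R \<epsilon> m, w) (u *\<^sub>R \<epsilon> m, w) = ((- u) *\<^sub>R \<epsilon> m, - w)"
        using root_nonzero[OF short_in_R[OF w(4) m(1)]]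
        by (simp add: refl_root_self inner_coroot scaleR_2 del: scaleR_eq_0_iff inner_scaleR_left inner_scaleR_right)
      then have "((- u) *\<^sub>R \<epsilon> m, - w) \<in> \<Psi>" using refl[OF w(5,5)] by simp
      moreover have "((- u) *\<^sub>R \<epsilon> m, - w) + (s *\<^sub>R \<epsilon> k, y) = ((- u) *\<^sub>R \<epsilon> m + s *\<^sub>R \<epsilon> k, l)"
        using w(1) by simp
      moreover have "((- u) *\<^sub>R \<epsilon> m + s *\<^sub>R \<epsilon> k, l) \<in> real_roots R \<Lambda>"
        using long_in_R[OF mu s m(1,3)] Lambda_long_root[OF mu s m(1,3)] m(2) w(2)
        by (auto simp: real_roots_def)
      ultimately have "((- u) *\<^sub>R \<epsilon> m + s *\<^sub>R \<epsilon> k, l) \<in> \<Psi>" using add y by metis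
      then have "(- u) *\<^sub>R \<epsilon> m + s *\<^sub>R \<epsilon> k \<in> ?G" using gradient_iff[OF sub] by blast
      from step[OF this mu s m(1,3) m(2)[symmetric] w(3)] show False using k by simp
    qed
    then show ?thesis using short_S[OF y s] k by (simp add: Z_def)
  qed
  have "\<exists>y. (\<alpha>, y) \<in> \<Psi>" "\<exists>y. (\<beta>, y) \<in> \<Psi>" using ab gradient_iff[OF sub] by auto
  then have "Z \<noteq> {}" "Z' \<noteq> {}"
    using in_Z[of s i] in_Z'[of t j] i j iJ jJ by blast+
  then have sp: "split_pair K Z J Z'"
    unfolding split_pair_def union_of_cosets_iff[OF L_additive_subgroup]
    using Jn jJ iJ i(2) Z'S ZL Z'L by (auto simp: K_def Z_def)
  have KJ: "K \<subseteq> {1..n}" by (simp add: K_def)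
  have "\<Psi> \<subseteq> block K Z \<union> block J Z'"
  proof
    fix x assume x: "x \<in> \<Psi>"
    then obtain \<gamma> y where xy: "x = (\<gamma>, y)" "\<gamma> \<in> R" "y \<in> \<Lambda> \<gamma>" using sub by (auto simp: real_roots_def)
    from xy(2) show "x \<in> block K Z \<union> block J Z'"
    proof (cases rule: root_cases)
      case (short s k)
      have mem: "(s *\<^sub>R \<epsilon> k, y) \<in> \<Psi>" using x unfolding xy(1) short(3) .
      show ?thesis
      proof (cases "k \<in> J")
        case True
        then show ?thesis
          unfolding xy(1) short(3) Un_iff short_in_block_iff[OF Jn short(1,2)]
          using in_Z'[OF mem short(1)] by blast
      next
        case False
        then have "k \<in> K" using short(2) unfolding K_def by blast
        then show ?thesis
          unfolding xy(1) short(3) Un_iff short_in_block_iff[OF KJ short(1,2)]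
          using in_Z[OF mem short(1)] K_def by blast
      qed
    next
      case (long s t p q)
      have y: "y \<in> L" using xy(3) unfolding long(6) Lambda_long_root[OF long(1-5)] .
      have g: "s *\<^sub>R \<epsilon> p + t *\<^sub>R \<epsilon> q \<in> ?G"
        using x unfolding xy(1) long(6) gradient_iff[OF sub] by blast
      then have g': "t *\<^sub>R \<epsilon> q + s *\<^sub>R \<epsilon> p \<in> ?G" by (simp only: add.commute)
      have "p \<in> J \<longleftrightarrow> q \<in> J"
        using step[OF g long(1-5)] step[OF g' long(2,1,4,3) long(5)[symmetric]] by blast
      then show ?thesis
        unfolding xy(1) long(6) Un_iff long_in_block_iff[OF KJ long(1-5)]
          long_in_block_iff[OF Jn long(1-5)]
        using y long(3,4) K_def by blast
    qed
  qed
  moreover have "closed_subroot_system R \<Lambda> (block K Z \<union> block J Z')"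
    by (rule split_pair_closed[OF sp])
  \<comment> \<open>A closed subroot system is proper by definition, so maximality rules out strict
    inclusion.\<close>
  ultimately have "\<Psi> = block K Z \<union> block J Z'"
    using max unfolding maximal_closed_subroot_system_def closed_subroot_system_def subroot_system_def
    by blast
  then show ?thesis using sp by blast
qed

lemma maximal_semi_closed_iff:
  "maximal_closed_subroot_system R \<Lambda> \<Psi> \<and> semi_closed_roots R (gradient R \<Lambda> \<Psi>) \<longleftrightarrow>
    (\<exists>K Z K' Z'. split_pair K Z K' Z' \<and> \<Psi> = block K Z \<union> block K' Z')"
proof (intro iffI)
  assume "maximal_closed_subroot_system R \<Lambda> \<Psi> \<and> semi_closed_roots R (gradient R \<Lambda> \<Psi>)"
  then show "\<exists>K Z K' Z'. split_pair K Z K' Z' \<and> \<Psi> = block K Z \<union> block K' Z'"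
    by (elim conjE) (rule semi_closed_maximal_imp_split)
qed (auto simp only: split_pair_maximal split_pair_semi_closed)

end

theorem theorem5:
  fixes n :: nat
    and \<epsilon> :: "nat \<Rightarrow> 'v::euclidean_space"
    and R :: "'v set"
    and Y :: "'y::real_vector set"
    and \<Lambda> :: "'v \<Rightarrow> 'y set"
    and \<Lambda>\<^sub>s \<Lambda>\<^sub>l :: "'y set"
    and \<Psi> :: "('v \<times> 'y) set"
  assumes "n \<ge> 2"
    and "orthonormal_basis n \<epsilon>"
    and "R = roots_B n \<epsilon>"
    and "irreducible_affine_reflection_datum R Y \<Lambda>"
    and "\<Lambda>\<^sub>s = Lambda_short R \<Lambda>"
    and "\<Lambda>\<^sub>l = Lambda_long R \<Lambda>"
    and "n = 2 \<Longrightarrow> additive_subgroup \<Lambda>\<^sub>l"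
    and "\<Psi> \<subseteq> affine_roots R \<Lambda>"
  shows "(maximal_closed_subroot_system R \<Lambda> \<Psi> \<and> semi_closed_roots R (gradient R \<Lambda> \<Psi>)) \<longleftrightarrow>
    (\<exists>J Z\<^sub>1 Z\<^sub>2.
       J \<noteq> {} \<and> J \<subset> {1..n} \<and>
       Z\<^sub>1 \<noteq> {} \<and> Z\<^sub>2 \<noteq> {} \<and> Z\<^sub>1 \<subseteq> \<Lambda>\<^sub>s \<and> Z\<^sub>2 \<subseteq> \<Lambda>\<^sub>s \<and> Z\<^sub>1 \<inter> Z\<^sub>2 = {} \<and>
       union_of_cosets \<Lambda>\<^sub>l Z\<^sub>1 \<and> union_of_cosets \<Lambda>\<^sub>l Z\<^sub>2 \<and> \<Lambda>\<^sub>s = Z\<^sub>1 \<union> Z\<^sub>2 \<and>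
       \<Psi> =
         {(s *\<^sub>R \<epsilon> i, z) | s i z. s \<in> {1, -1} \<and> i \<in> {1..n} - J \<and> z \<in> Z\<^sub>1} \<union>
         {(s *\<^sub>R \<epsilon> j, z) | s j z. s \<in> {1, -1} \<and> j \<in> J \<and> z \<in> Z\<^sub>2} \<union>
         {(s *\<^sub>R \<epsilon> p + t *\<^sub>R \<epsilon> q, y) | s t p q y.
            s \<in> {1, -1} \<and> t \<in> {1, -1} \<and> p \<in> {1..n} \<and> q \<in> {1..n} \<and> p \<noteq> q \<and>
            ((p \<notin> J \<and> q \<notin> J) \<or> (p \<in> J \<and> q \<in> J)) \<and> y \<in> \<Lambda>\<^sub>l})"
proof -
  interpret type_B_datum n \<epsilon> Y \<Lambda>
    using assms by unfold_locales simp_all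
  \<comment> \<open>\<open>Lambda_long_eq\<close> from the first interpretation translates the
    hypothesis on \<open>\<Lambda>\<^sub>l\<close> into one on \<open>L\<close>.\<close>
  interpret type_B_datum_subgroup n \<epsilon> Y \<Lambda>
    using assms Lambda_long_eq by unfold_locales simp
  have SL: "\<Lambda>\<^sub>s = S" "\<Lambda>\<^sub>l = L" using assms Lambda_short_eq Lambda_long_eq by simp_all
  let ?E = "\<lambda>J Z\<^sub>1 Z\<^sub>2. {(s *\<^sub>R \<epsilon> i, z) | s i z. s \<in> {1, -1} \<and> i \<in> {1..n} - J \<and> z \<in> Z\<^sub>1} \<union>
         {(s *\<^sub>R \<epsilon> j, z) | s j z. s \<in> {1, -1} \<and> j \<in> J \<and> z \<in> Z\<^sub>2} \<union>
         {(s *\<^sub>R \<epsilon> p + t *\<^sub>R \<epsilon> q, y) | s t p q y.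
            s \<in> {1, -1} \<and> t \<in> {1, -1} \<and> p \<in> {1..n} \<and> q \<in> {1..n} \<and> p \<noteq> q \<and>
            ((p \<notin> J \<and> q \<notin> J) \<or> (p \<in> J \<and> q \<in> J)) \<and> y \<in> L}"
  have expand: "block ({1..n} - J) Z\<^sub>1 \<union> block J Z\<^sub>2 = ?E J Z\<^sub>1 Z\<^sub>2" (is "_ = ?A \<union> ?B \<union> ?C")
    if J: "J \<subseteq> {1..n}" for J and Z\<^sub>1 Z\<^sub>2 :: "'y set"
  proof -
    let ?long = "\<lambda>K. {(s *\<^sub>R \<epsilon> p + t *\<^sub>R \<epsilon> q, y) | s t p q y.
       s \<in> sgns \<and> t \<in> sgns \<and> p \<in> K \<and> q \<in> K \<and> p \<noteq> q \<and> y \<in> L}"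
    have C: "?C = ?long ({1..n} - J) \<union> ?long J"
      using J by blast
    have "\<And>A B C D :: ('v \<times> 'y) set. (A \<union> C) \<union> (B \<union> D) = (A \<union> B) \<union> (C \<union> D)" by blast
    then show ?thesis
      unfolding block_eq[OF J] block_eq[OF Diff_subset] C .
  qed
  \<comment> \<open>\<open>K\<close> is the complement of \<open>K'\<close>; this equation
    eliminates the existential over \<open>K\<close> and leaves \<open>J\<close> as the only index
    set.\<close>
  have index: "split_pair K Z K' Z' \<longleftrightarrow> K = {1..n} - K' \<and> split_pair ({1..n} - K') Z K' Z'" for K Z K' Z'
    by (auto simp: split_pair_def)
  have split: "split_pair ({1..n} - J) Z\<^sub>1 J Z\<^sub>2 \<longleftrightarrow>
    J \<noteq> {} \<and> J \<subset> {1..n} \<and>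
       Z\<^sub>1 \<noteq> {} \<and> Z\<^sub>2 \<noteq> {} \<and> Z\<^sub>1 \<subseteq> S \<and> Z\<^sub>2 \<subseteq> S \<and> Z\<^sub>1 \<inter> Z\<^sub>2 = {} \<and>
       union_of_cosets L Z\<^sub>1 \<and> union_of_cosets L Z\<^sub>2 \<and> S = Z\<^sub>1 \<union> Z\<^sub>2" for J Z\<^sub>1 Z\<^sub>2
    unfolding split_pair_def by blast
  have "(\<exists>K Z\<^sub>1 J Z\<^sub>2. split_pair K Z\<^sub>1 J Z\<^sub>2 \<and> \<Psi> = block K Z\<^sub>1 \<union> block J Z\<^sub>2) \<longleftrightarrow>
    (\<exists>J Z\<^sub>1 Z\<^sub>2. split_pair ({1..n} - J) Z\<^sub>1 J Z\<^sub>2 \<and> \<Psi> = block ({1..n} - J) Z\<^sub>1 \<union> block J Z\<^sub>2)"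
    by (subst index) blast
  also have "\<dots> \<longleftrightarrow> (\<exists>J Z\<^sub>1 Z\<^sub>2. split_pair ({1..n} - J) Z\<^sub>1 J Z\<^sub>2 \<and> \<Psi> = ?E J Z\<^sub>1 Z\<^sub>2)"
  proof (intro ex_cong1 conj_cong refl)
    fix J Z\<^sub>1 Z\<^sub>2 assume "split_pair ({1..n} - J) Z\<^sub>1 J Z\<^sub>2"
    then have "J \<subseteq> {1..n}" unfolding split by blast
    from expand[OF this] show "\<Psi> = block ({1..n} - J) Z\<^sub>1 \<union> block J Z\<^sub>2 \<longleftrightarrow> \<Psi> = ?E J Z\<^sub>1 Z\<^sub>2"
      by (simp only:)
  qed
  finally show ?thesis
    unfolding SL assms(3) maximal_semi_closed_iff split by (simp only: conj_assoc)
qed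

end
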